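(* Let $C>1$ be a constant, let $d=\omega(1)$, let $n=\omega(d^2)$, and let $p\le\frac{C}{d}$. Then (for $n,d$ satisfying suitable parity and divisibility conditions) there exists a $d$-regular $n$-vertex graph $G$ with $i(G)\ge\frac{1}{40C}$ such that with high probability all components of $G_p$ have order at most $3d\log n$.
   Context: $G_p$ denotes the random subgraph of $G$ obtained by retaining each edge independently with probability $p$. For $S\subseteq V(G)$, $\partial_G(S)$ is the number of edges of $G$ with exactly one endpoint in $S$, and $i(G)=\min\{\partial_G(S)/|S| : S\subseteq V(G),\ 1\le|S|\le |V(G)|/2\}$. "With high probability" means with probability tending to $1$ as $d\to\infty$. *)

theory Defs
  imports "HOL-Probability.Probability" "HOL-Library.Landau_Symbols"
begin

type_synonym 'a ugraph = "'a set \<times> 'a set set"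

abbreviation verts :: "'a ugraph \<Rightarrow> 'a set" where
  "verts G \<equiv> fst G"

abbreviation edges :: "'a ugraph \<Rightarrow> 'a set set" where
  "edges G \<equiv> snd G"

definition finite_simple_graph :: "'a ugraph \<Rightarrow> bool" where
  "finite_simple_graph G \<longleftrightarrow>
     finite (verts G) \<and> (\<forall>e\<in>edges G. e \<subseteq> verts G \<and> card e = 2)"

definition vertex_degree :: "'a ugraph \<Rightarrow> 'a \<Rightarrow> nat" where
  "vertex_degree G v = card {e \<in> edges G. v \<in> e}"

definition regular_graph :: "nat \<Rightarrow> 'a ugraph \<Rightarrow> bool" where
  "regular_graph d G \<longleftrightarrow> (\<forall>v\<in>verts G. vertex_degree G v = d)"

definition edge_boundary :: "'a ugraph \<Rightarrow> 'a set \<Rightarrow> nat" where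
  "edge_boundary G S = card {e \<in> edges G. card (e \<inter> S) = 1}"

text \<open>For a finite graph on at least two vertices the minimum below is over a finite non-empty
  set; for fewer vertices the value is unspecified.\<close>

definition isoperimetric_constant :: "'a ugraph \<Rightarrow> real" where
  "isoperimetric_constant G =
     Min {real (edge_boundary G S) / real (card S) | S.
            S \<subseteq> verts G \<and> 1 \<le> card S \<and> real (card S) \<le> real (card (verts G)) / 2}"

definition component_of :: "'a ugraph \<Rightarrow> 'a \<Rightarrow> 'a set" where
  "component_of G u = {v \<in> verts G. (\<lambda>x y. {x, y} \<in> edges G)\<^sup>*\<^sup>* u v}"

definition graph_components :: "'a ugraph \<Rightarrow> 'a set set" where
  "graph_components G = component_of G ` verts G"

definition random_subgraph :: "'a ugraph \<Rightarrow> real \<Rightarrow> 'a ugraph pmf" where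
  "random_subgraph G p =
     map_pmf (\<lambda>keep. (verts G, {e \<in> edges G. keep e}))
       (Pi_pmf (edges G) False (\<lambda>_. bernoulli_pmf p))"

end

theory Submission
  imports Defs "HOL-Combinatorics.Permutations"
begin

text \<open>
  Split the vertices into \<open>m\<close> clusters of size \<open>d + 1\<close> or \<open>d + 3\<close>, each carrying a nearly complete
  \<open>d\<close>-regular graph, and rewire \<open>r \<approx> d / (8 C)\<close> disjoint edges of every cluster along \<open>r\<close>
  permutations of the clusters. For suitable permutations (a first-moment argument) the
  resulting multigraph on the clusters is an expander; since a set that splits a
  cluster pays about \<open>d / 2\<close> inner edges per minority vertex, this gives the isoperimetric bound.
  After percolation a cluster keeps on average at most \<open>2 r C / d \<le> 1 / 4\<close> of its outgoing edges, so
  exploring clusters is a subcritical branching process, and no component meets more than about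
  \<open>3 ln n\<close> clusters.
\<close>

section \<open>Expanding families of permutations\<close>

lemma card_permutes_into_insert:
  assumes A: "finite A" and X: "X \<subseteq> A" and Y: "Y \<subseteq> A" and v: "v \<in> A - Y"
  shows "(card A - card Y) * card {f. f permutes A \<and> f ` insert v Y \<subseteq> X} =
         (card X - card Y) * card {f. f permutes A \<and> f ` Y \<subseteq> X}"
proof -
  define P where "P = (\<lambda>Z. {f. f permutes A \<and> f ` Z \<subseteq> X})"
  have fP: "finite (P Z)" for Z
    unfolding P_def by (rule finite_subset[OF _ finite_permutations[OF A]]) auto
  have fY: "finite Y" using A Y finite_subset by blast
  have le: "card (P (insert u Y)) \<le> card (P (insert w Y))"
    if "u \<in> A - Y" "w \<in> A - Y" for u w
  proof (rule card_inj_on_le)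
    show "inj_on (\<lambda>f. f \<circ> Transposition.transpose u w) (P (insert u Y))"
    proof (rule inj_onI)
      fix f g assume "f \<circ> Transposition.transpose u w = g \<circ> Transposition.transpose u w"
      then have "f \<circ> (Transposition.transpose u w \<circ> Transposition.transpose u w) =
                 g \<circ> (Transposition.transpose u w \<circ> Transposition.transpose u w)"
        by (simp only: o_assoc)
      then show "f = g" by simp
    qed
    show "(\<lambda>f. f \<circ> Transposition.transpose u w) ` P (insert u Y) \<subseteq> P (insert w Y)"
    proof (rule image_subsetI)
      fix f assume f: "f \<in> P (insert u Y)"
      have "f \<circ> Transposition.transpose u w permutes A"
        using f that by (intro permutes_compose permutes_swap_id) (auto simp: P_def)
      moreover have "(f \<circ> Transposition.transpose u w) y \<in> X" if "y \<in> insert w Y" for y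
        using that f \<open>u \<in> A - Y\<close> \<open>w \<in> A - Y\<close>
        by (auto simp: P_def Transposition.transpose_def)
      ultimately show "f \<circ> Transposition.transpose u w \<in> P (insert w Y)"
        unfolding P_def by blast
    qed
  qed (rule fP)
  have eq: "card (P (insert u Y)) = card (P (insert v Y))" if "u \<in> A - Y" for u
    using le[OF that v] le[OF v that] by simp
  have cnt: "card {u \<in> A - Y. f u \<in> X} = card X - card Y" if f: "f \<in> P Y" for f
  proof -
    have pf: "f permutes A" and fYX: "f ` Y \<subseteq> X" using f by (auto simp: P_def)
    have "f ` {u \<in> A. f u \<in> X} = X"
    proof (intro subset_antisym subsetI)
      fix x assume x: "x \<in> X"
      then have "x \<in> f ` A" using X permutes_image[OF pf] by blast
      then show "x \<in> f ` {u \<in> A. f u \<in> X}" using x by blast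
    qed blast
    moreover have "inj f" using pf permutes_inj by blast
    ultimately have "card {u \<in> A. f u \<in> X} = card X"
      using card_image[of f "{u \<in> A. f u \<in> X}"] by (simp add: inj_on_def)
    moreover have "{u \<in> A - Y. f u \<in> X} = {u \<in> A. f u \<in> X} - Y" by auto
    moreover have "Y \<subseteq> {u \<in> A. f u \<in> X}" using Y fYX by auto
    ultimately show ?thesis using fY by (simp add: card_Diff_subset)
  qed
  have "(card A - card Y) * card (P (insert v Y)) = (\<Sum>u\<in>A - Y. card (P (insert u Y)))"
    using eq A Y fY by (simp add: card_Diff_subset)
  also have "\<dots> = (\<Sum>u\<in>A - Y. \<Sum>f\<in>P Y. if f u \<in> X then 1 else 0)"
  proof (rule sum.cong[OF refl])
    fix u
    have "P (insert u Y) = {f \<in> P Y. f u \<in> X}" by (auto simp: P_def)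
    then show "card (P (insert u Y)) = (\<Sum>f\<in>P Y. if f u \<in> X then 1 else 0)"
      using fP[of Y] by (simp add: sum.If_cases Int_def)
  qed
  also have "\<dots> = (\<Sum>f\<in>P Y. \<Sum>u\<in>A - Y. if f u \<in> X then 1 else 0)"
    by (rule sum.swap)
  also have "\<dots> = (\<Sum>f\<in>P Y. card {u \<in> A - Y. f u \<in> X})"
    using A by (intro sum.cong) (auto simp: sum.If_cases Int_def)
  also have "\<dots> = (card X - card Y) * card (P Y)"
    using cnt by simp
  finally show ?thesis by (simp add: P_def)
qed

lemma card_permutes_into_le:
  assumes A: "finite A" and X: "X \<subseteq> A" and Y: "Y \<subseteq> A"
  shows "real (card {f. f permutes A \<and> f ` Y \<subseteq> X})
           \<le> fact (card A) * (real (card X) / real (card A)) ^ card Y"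
proof -
  have "finite Y" using A Y finite_subset by blast
  then show ?thesis using Y
  proof (induction Y rule: finite_induct)
    case empty
    then show ?case using card_permutations[OF refl A] by simp
  next
    case (insert v Y)
    let ?x = "card X" and ?m = "card A" and ?y = "card Y"
    let ?N = "real (card {f. f permutes A \<and> f ` Y \<subseteq> X})"
    let ?N' = "real (card {f. f permutes A \<and> f ` insert v Y \<subseteq> X})"
    have ym: "?y < ?m"
      using insert.prems insert.hyps A by (intro psubset_card_mono) auto
    have xm: "?x \<le> ?m" using X A card_mono by blast
    have "(?m - ?y) * card {f. f permutes A \<and> f ` insert v Y \<subseteq> X} =
          (?x - ?y) * card {f. f permutes A \<and> f ` Y \<subseteq> X}"
      using insert A X by (intro card_permutes_into_insert) auto
    then have "real (?m - ?y) * ?N' = real (?x - ?y) * ?N"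
      by (simp only: of_nat_mult[symmetric])
    then have "?N' = real (?x - ?y) / real (?m - ?y) * ?N"
      using ym by (simp add: field_simps)
    also have "\<dots> \<le> real ?x / real ?m * ?N"
    proof (rule mult_right_mono)
      show "real (?x - ?y) / real (?m - ?y) \<le> real ?x / real ?m"
      proof (cases "?x \<le> ?y")
        case False
        have "real ?y * real ?x \<le> real ?y * real ?m"
          using xm by (intro mult_left_mono) auto
        then show ?thesis using False ym by (simp add: field_simps of_nat_diff)
      qed simp
    qed simp
    also have "\<dots> \<le> real ?x / real ?m * (fact ?m * (real ?x / real ?m) ^ ?y)"
      using insert by (intro mult_left_mono) auto
    finally show ?case using insert.hyps by (simp add: mult_ac)
  qed
qed

lemma sum_Pow_power_card:
  fixes a :: "'b :: comm_semiring_1"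
  assumes "finite X"
  shows "(\<Sum>Y\<in>Pow X. a ^ card Y) = (1 + a) ^ card X"
  using prod_add[OF assms, of "\<lambda>_. a" "\<lambda>_. 1"] by (simp add: add.commute)

lemma sum_permutes_power_le:
  fixes z :: real
  assumes A: "finite A" and X: "X \<subseteq> A" and z: "z \<ge> 1"
  shows "(\<Sum>f | f permutes A. z ^ card {i \<in> X. f i \<in> X})
           \<le> fact (card A) * (1 + (z - 1) * (card X / card A)) ^ card X"
proof -
  let ?P = "{f. f permutes A}"
  have fX: "finite X" using A X finite_subset by blast
  have fP: "finite ?P" using finite_permutations[OF A] .
  have "(\<Sum>f\<in>?P. z ^ card {i \<in> X. f i \<in> X}) =
        (\<Sum>f\<in>?P. \<Sum>Y\<in>Pow X. if f ` Y \<subseteq> X then (z - 1) ^ card Y else 0)"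
  proof (rule sum.cong[OF refl])
    fix f
    have "z ^ card {i \<in> X. f i \<in> X} = (\<Sum>Y\<in>Pow {i \<in> X. f i \<in> X}. (z - 1) ^ card Y)"
      using fX by (subst sum_Pow_power_card) auto
    also have "Pow {i \<in> X. f i \<in> X} = {Y \<in> Pow X. f ` Y \<subseteq> X}" by auto
    also have "(\<Sum>Y\<in>{Y \<in> Pow X. f ` Y \<subseteq> X}. (z - 1) ^ card Y) =
        (\<Sum>Y\<in>Pow X. if f ` Y \<subseteq> X then (z - 1) ^ card Y else 0)"
      using fX by (subst sum.inter_filter) auto
    finally show "z ^ card {i \<in> X. f i \<in> X} =
        (\<Sum>Y\<in>Pow X. if f ` Y \<subseteq> X then (z - 1) ^ card Y else 0)" .
  qed
  also have "\<dots> = (\<Sum>Y\<in>Pow X. \<Sum>f\<in>?P. if f ` Y \<subseteq> X then (z - 1) ^ card Y else 0)"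
    by (rule sum.swap)
  also have "\<dots> = (\<Sum>Y\<in>Pow X. (z - 1) ^ card Y * card {f. f permutes A \<and> f ` Y \<subseteq> X})"
    using fP by (intro sum.cong) (auto simp: sum.If_cases Int_def)
  also have "\<dots> \<le> (\<Sum>Y\<in>Pow X. (z - 1) ^ card Y *
                     (fact (card A) * (real (card X) / real (card A)) ^ card Y))"
    using z A X by (intro sum_mono mult_left_mono card_permutes_into_le) auto
  also have "\<dots> = fact (card A) * (\<Sum>Y\<in>Pow X. ((z - 1) * (card X / card A)) ^ card Y)"
    unfolding sum_distrib_left power_mult_distrib by (simp only: mult_ac)
  finally show ?thesis by (simp add: sum_Pow_power_card[OF fX])
qed

lemma exists_seq_sum_prod_le:
  fixes f :: "'x \<Rightarrow> 'p \<Rightarrow> real" and g :: "'x \<Rightarrow> real"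
  assumes P: "finite P" "P \<noteq> {}"
    and f: "\<And>X \<pi>. X \<in> \<X> \<Longrightarrow> \<pi> \<in> P \<Longrightarrow> f X \<pi> \<ge> 0"
    and g: "\<And>X. X \<in> \<X> \<Longrightarrow> g X \<ge> 0"
    and avg: "\<And>X. X \<in> \<X> \<Longrightarrow> (\<Sum>\<pi>\<in>P. f X \<pi>) \<le> real (card P) * g X"
  shows "\<exists>\<pi>. (\<forall>j::nat. \<pi> j \<in> P) \<and> (\<Sum>X\<in>\<X>. \<Prod>j<r. f X (\<pi> j)) \<le> (\<Sum>X\<in>\<X>. g X ^ r)"
proof -
  have step: "\<exists>\<pi>\<in>P. (\<Sum>X\<in>\<X>. w X * f X \<pi>) \<le> (\<Sum>X\<in>\<X>. w X * g X)"
    if w: "\<And>X. X \<in> \<X> \<Longrightarrow> w X \<ge> 0" for w :: "'x \<Rightarrow> real"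
  proof (rule ccontr)
    assume "\<not> ?thesis"
    then have "(\<Sum>\<pi>\<in>P. \<Sum>X\<in>\<X>. w X * g X) < (\<Sum>\<pi>\<in>P. \<Sum>X\<in>\<X>. w X * f X \<pi>)"
      using P by (intro sum_strict_mono[of P]) (simp_all add: not_le)
    also have "\<dots> = (\<Sum>X\<in>\<X>. w X * (\<Sum>\<pi>\<in>P. f X \<pi>))"
      by (subst sum.swap) (simp add: sum_distrib_left)
    also have "\<dots> \<le> (\<Sum>X\<in>\<X>. w X * (real (card P) * g X))"
      using avg w by (intro sum_mono mult_left_mono) auto
    finally show False by (simp add: sum_distrib_left mult_ac)
  qed
  have "\<exists>\<pi>. (\<forall>j::nat. \<pi> j \<in> P) \<and>
          (\<Sum>X\<in>\<X>. (\<Prod>j<t. f X (\<pi> j)) * g X ^ u) \<le> (\<Sum>X\<in>\<X>. g X ^ (t + u))" for t u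
  proof (induction t arbitrary: u)
    case 0
    then show ?case using P(2) by (intro exI[of _ "\<lambda>_. SOME \<pi>. \<pi> \<in> P"]) (auto simp: some_in_eq)
  next
    case (Suc t)
    obtain \<pi> where \<pi>: "\<And>j. \<pi> j \<in> P"
      "(\<Sum>X\<in>\<X>. (\<Prod>j<t. f X (\<pi> j)) * g X ^ Suc u) \<le> (\<Sum>X\<in>\<X>. g X ^ (t + Suc u))"
      using Suc.IH[of "Suc u"] by blast
    obtain \<sigma> where \<sigma>: "\<sigma> \<in> P"
      "(\<Sum>X\<in>\<X>. (\<Prod>j<t. f X (\<pi> j)) * g X ^ u * f X \<sigma>) \<le>
       (\<Sum>X\<in>\<X>. (\<Prod>j<t. f X (\<pi> j)) * g X ^ u * g X)"
      using step[of "\<lambda>X. (\<Prod>j<t. f X (\<pi> j)) * g X ^ u"]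
      by (metis (no_types, lifting) f g \<pi>(1) mult_nonneg_nonneg prod_nonneg zero_le_power)
    have "(\<Sum>X\<in>\<X>. (\<Prod>j<Suc t. f X ((\<pi>(t := \<sigma>)) j)) * g X ^ u) =
          (\<Sum>X\<in>\<X>. (\<Prod>j<t. f X (\<pi> j)) * g X ^ u * f X \<sigma>)"
      by (intro sum.cong) (auto simp: mult_ac)
    then show ?case
      using \<pi> \<sigma> by (intro exI[of _ "\<pi>(t := \<sigma>)"]) (auto simp: mult_ac)
  qed
  from this[of r 0] show ?thesis by simp
qed

lemma power_self_le_exp_fact: "real x ^ x \<le> exp 1 ^ x * fact x"
proof -
  let ?f = "\<lambda>n. real x ^ n /\<^sub>R fact n"
  have "summable ?f" "suminf ?f = exp (real x)"
    using exp_converges[of "real x"] by (auto simp: sums_iff)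
  then have "?f x \<le> exp (real x)"
    using sum_le_suminf[of ?f "{x}"] by simp
  then show ?thesis
    by (simp add: field_simps exp_of_nat_mult[symmetric])
qed

lemma binomial_le_exp_power:
  assumes "x \<le> m" "0 < x"
  shows "real (m choose x) \<le> (exp 1 * (real m / real x)) ^ x"
proof -
  have "fact m = (fact x * (m choose x)) * (fact (m - x) :: nat)"
    using binomial_fact_lemma[OF assms(1)] by (simp add: mult_ac)
  then have "fact x * (m choose x) = fact m div (fact (m - x) :: nat)"
    by simp
  also have "\<dots> \<le> m ^ x" using fact_div_fact_le_pow[OF assms(1)] .
  finally have "real (fact x * (m choose x)) \<le> real (m ^ x)"
    by (simp only: of_nat_le_iff)
  then have 1: "fact x * real (m choose x) \<le> real m ^ x" by simp
  have "real x ^ x * real (m choose x) \<le> exp 1 ^ x * fact x * real (m choose x)"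
    using power_self_le_exp_fact[of x] by (intro mult_right_mono) auto
  also have "\<dots> \<le> exp 1 ^ x * real m ^ x"
    using mult_left_mono[OF 1, of "exp 1 ^ x"] by (simp add: mult_ac)
  finally show ?thesis using assms
    by (simp add: power_mult_distrib power_divide field_simps)
qed

lemma moment_base_bounds:
  fixes u :: real
  assumes "0 < u" "u \<le> 1 / 2"
  defines "a \<equiv> (2 - u) * u powr (3 / 4)"
  shows "0 \<le> a" "a \<le> 1" "a ^ 4 \<le> 16 * u" "a ^ 4 \<le> 27 / 32"
proof -
  have u3: "(u powr (3 / 4)) ^ 4 = u ^ 3"
    using assms by (simp add: powr_power)
  have a4: "a ^ 4 = (2 - u) ^ 4 * u ^ 3" by (simp add: a_def power_mult_distrib u3)
  show "0 \<le> a" using assms by (simp add: a_def)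
  have "u ^ 3 \<le> u"
    using assms power_decreasing[of 1 3 u] by simp
  moreover have "(2 - u) ^ 4 \<le> 2 ^ 4" using assms by (intro power_mono) auto
  ultimately show "a ^ 4 \<le> 16 * u"
    unfolding a4 using assms mult_mono[of "(2 - u) ^ 4" 16 "u ^ 3" u] by simp
  have "1 / 4 \<le> (1 - u) ^ 2"
    using assms power_mono[of "1 / 2" "1 - u" 2] by (simp add: power2_eq_square)
  then have "(2 - u) * u \<le> 3 / 4" by (simp add: power2_eq_square algebra_simps)
  then have "((2 - u) * u) ^ 3 \<le> (3 / 4) ^ 3" using assms by (intro power_mono) auto
  then have "(2 - u) * ((2 - u) * u) ^ 3 \<le> 2 * (3 / 4) ^ 3"
    using assms by (intro mult_mono) auto
  moreover have "a ^ 4 = (2 - u) * ((2 - u) * u) ^ 3"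
    unfolding a4 by (simp add: power_mult_distrib power_Suc[symmetric] mult.assoc[symmetric] del: power_Suc)
  ultimately show *: "a ^ 4 \<le> 27 / 32" by (simp add: power3_eq_cube)
  show "a \<le> 1"
  proof (rule ccontr)
    assume "\<not> a \<le> 1"
    then have "1 \<le> a ^ 4" by (intro one_le_power) auto
    then show False using * by simp
  qed
qed

lemma moment_base_power_le:
  fixes u :: real
  assumes u: "0 < u" "u \<le> 1 / 2" and r: "r \<ge> 124"
  shows "exp 1 / u * ((2 - u) * u powr (3 / 4)) ^ r \<le> 1 / 3"
proof -
  define a where "a = (2 - u) * u powr (3 / 4)"
  note a = moment_base_bounds[OF u, folded a_def]
  have "a ^ r \<le> a ^ (4 + 4 * 30)"
    using a r by (intro power_decreasing) auto
  also have "\<dots> = a ^ 4 * (a ^ 4) ^ 30"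
    by (simp only: power_add power_mult)
  also have "\<dots> \<le> 16 * u * (27 / 32) ^ 30"
    using a u by (intro mult_mono power_mono) auto
  finally have "exp 1 / u * a ^ r \<le> exp 1 / u * (16 * u * (27 / 32) ^ 30)"
    using u by (intro mult_left_mono) auto
  also have "\<dots> = exp 1 * (16 * (27 / 32) ^ 30)" using u by simp
  also have "\<dots> \<le> 3 * (16 * (27 / 32) ^ 30)"
    using exp_le by (intro mult_right_mono) auto
  also have "\<dots> \<le> 1 / 3" by (simp add: field_simps)
  finally show ?thesis by (simp add: a_def)
qed

lemma sum_third_powers: "(\<Sum>x\<in>{1..m}. (1 / 3 :: real) ^ x) = 1 / 2 - (1 / 3) ^ m / 2"
  by (induction m) simp_all

text \<open>First-moment method: for \<open>|X| = u m\<close> the weight \<open>(1/u) ^ |\<pi> X \<inter> X| * u powr (3/4 |X|)\<close> is at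
  least 1 when \<open>\<pi>\<close> keeps three quarters of \<open>X\<close> inside \<open>X\<close>, and averages at most
  \<open>((2 - u) * u powr (3/4)) ^ |X|\<close> over all permutations.\<close>
lemma exists_expanding_permutations:
  assumes r: "r \<ge> 124"
  shows "\<exists>\<pi> :: nat \<Rightarrow> nat \<Rightarrow> nat. (\<forall>j. \<pi> j permutes {..<m}) \<and>
           (\<forall>X. X \<subseteq> {..<m} \<longrightarrow> 2 * card X \<le> m \<longrightarrow>
              real r * real (card X) / 4 \<le> (\<Sum>j<r. real (card {i \<in> X. \<pi> j i \<notin> X})))"
proof -
  define P where "P = {f. f permutes {..<m}}"
  define \<X> where "\<X> = {X. X \<subseteq> {..<m} \<and> X \<noteq> {} \<and> 2 * card X \<le> m}"
  define u where "u = (\<lambda>X::nat set. real (card X) / real m)"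
  define b where "b = (\<lambda>X. u X powr (3 / 4))"
  define f where "f = (\<lambda>X (\<sigma>::nat \<Rightarrow> nat). (1 / u X) ^ card {i \<in> X. \<sigma> i \<in> X} * b X ^ card X)"
  define g where "g = (\<lambda>X. ((2 - u X) * b X) ^ card X)"
  have finX: "finite X" if "X \<in> \<X>" for X
    using that finite_subset by (auto simp: \<X>_def)
  have u: "0 < u X" "u X \<le> 1 / 2" "0 < card X" "0 < m" if "X \<in> \<X>" for X
  proof -
    show "0 < card X" using that finX[OF that] by (auto simp: \<X>_def card_gt_0_iff)
    moreover have "2 * card X \<le> m" using that by (simp add: \<X>_def)
    ultimately show "0 < u X" "u X \<le> 1 / 2" "0 < m"
      by (auto simp: u_def field_simps)
  qed
  have cP: "real (card P) = fact m"
    using card_permutations[of "{..<m}" m] by (simp add: P_def)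
  have fin\<X>: "finite \<X>" unfolding \<X>_def by (rule finite_subset[of _ "Pow {..<m}"]) auto
  have f0: "f X \<sigma> \<ge> 0" if "X \<in> \<X>" for X \<sigma>
    using u[OF that] by (simp add: f_def b_def)
  have "\<exists>\<pi>. (\<forall>j::nat. \<pi> j \<in> P) \<and> (\<Sum>X\<in>\<X>. \<Prod>j<r. f X (\<pi> j)) \<le> (\<Sum>X\<in>\<X>. g X ^ r)"
  proof (rule exists_seq_sum_prod_le)
    show "finite P" unfolding P_def by (rule finite_permutations) simp
    show "P \<noteq> {}" using permutes_id[of "{..<m}"] unfolding P_def by blast
    show "g X \<ge> 0" if "X \<in> \<X>" for X
      using u[OF that] by (simp add: g_def b_def)
    show "(\<Sum>\<sigma>\<in>P. f X \<sigma>) \<le> real (card P) * g X" if X: "X \<in> \<X>" for X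
    proof -
      have "(\<Sum>\<sigma>\<in>P. f X \<sigma>) = (\<Sum>\<sigma>\<in>P. (1 / u X) ^ card {i \<in> X. \<sigma> i \<in> X}) * b X ^ card X"
        by (simp add: f_def sum_distrib_right)
      also have "\<dots> \<le> fact (card {..<m}) *
          (1 + (1 / u X - 1) * (card X / card {..<m})) ^ card X * b X ^ card X"
        unfolding P_def using X u[OF X]
        by (intro mult_right_mono sum_permutes_power_le) (auto simp: \<X>_def b_def)
      also have "1 + (1 / u X - 1) * (card X / card {..<m}) = 2 - u X"
        using u[OF X] by (simp add: u_def field_simps)
      finally show ?thesis by (simp add: cP g_def power_mult_distrib mult_ac)
    qed
  qed (use f0 in auto)
  then obtain \<pi> where \<pi>: "\<And>j::nat. \<pi> j \<in> P"
    and le: "(\<Sum>X\<in>\<X>. \<Prod>j<r. f X (\<pi> j)) \<le> (\<Sum>X\<in>\<X>. g X ^ r)" by blast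
  have "(\<Sum>X\<in>\<X>. g X ^ r) \<le> (\<Sum>X\<in>\<X>. (1 / 3) ^ card X / real (m choose card X))"
  proof (rule sum_mono)
    fix X assume X: "X \<in> \<X>"
    have xm: "card X \<le> m" using X by (simp add: \<X>_def)
    have ch: "real (m choose card X) \<le> (exp 1 / u X) ^ card X"
      using binomial_le_exp_power[OF xm] u[OF X] by (simp add: u_def)
    have "real (m choose card X) * g X ^ r \<le> (exp 1 / u X) ^ card X * g X ^ r"
      using ch u[OF X] by (intro mult_right_mono) (auto simp: g_def b_def)
    also have "\<dots> = (exp 1 / u X * ((2 - u X) * b X) ^ r) ^ card X"
    proof -
      have "g X ^ r = (((2 - u X) * b X) ^ r) ^ card X"
        unfolding g_def power_mult[symmetric] by (simp only: mult.commute)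
      then show ?thesis by (simp only: power_mult_distrib)
    qed
    also have "\<dots> \<le> (1 / 3) ^ card X"
      using moment_base_power_le[OF u(1,2)[OF X] r] u[OF X]
      by (intro power_mono) (auto simp: b_def)
    finally show "g X ^ r \<le> (1 / 3) ^ card X / real (m choose card X)"
      using xm by (simp add: field_simps)
  qed
  also have "\<dots> \<le> (\<Sum>x\<in>{1..m}. \<Sum>X\<in>{X. X \<subseteq> {..<m} \<and> card X = x}. (1 / 3) ^ x / real (m choose x))"
  proof -
    have "(\<Sum>X\<in>\<X>. (1 / 3) ^ card X / real (m choose card X)) =
        (\<Sum>x\<in>{1..m}. \<Sum>X\<in>{X \<in> \<X>. card X = x}. (1 / 3) ^ card X / real (m choose card X))"
    proof (rule sum.group[symmetric])
      show "card ` \<X> \<subseteq> {1..m}"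
      proof (rule image_subsetI)
        fix X assume "X \<in> \<X>"
        then show "card X \<in> {1..m}" using u(3)[of X] by (simp add: \<X>_def)
      qed
    qed (use fin\<X> in auto)
    also have "\<dots> \<le> (\<Sum>x\<in>{1..m}. \<Sum>X\<in>{X. X \<subseteq> {..<m} \<and> card X = x}. (1 / 3) ^ card X / real (m choose card X))"
      by (rule sum_mono, rule sum_mono2) (auto simp: \<X>_def)
    finally show ?thesis by simp
  qed
  also have "\<dots> = (\<Sum>x\<in>{1..m}. (1 / 3) ^ x)"
    by (intro sum.cong) (auto simp: n_subsets)
  also have "\<dots> = 1 / 2 - (1 / 3) ^ m / 2"
    by (rule sum_third_powers)
  finally have "(\<Sum>X\<in>\<X>. g X ^ r) \<le> 1 / 2 - (1 / 3) ^ m / 2" .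
  moreover have "(1 / 3 :: real) ^ m > 0" by simp
  ultimately have lt1: "(\<Sum>X\<in>\<X>. \<Prod>j<r. f X (\<pi> j)) < 1" using le by linarith
  have main: "real r * real (card X) / 4 \<le> (\<Sum>j<r. real (card {i \<in> X. \<pi> j i \<notin> X}))"
    if X: "X \<in> \<X>" for X
  proof -
    let ?I = "\<lambda>j. card {i \<in> X. \<pi> j i \<in> X}"
    have "(\<Prod>j<r. f X (\<pi> j)) \<le> (\<Sum>X\<in>\<X>. \<Prod>j<r. f X (\<pi> j))"
      using fin\<X> X f0 by (intro member_le_sum) (auto intro!: prod_nonneg)
    then have "(\<Prod>j<r. f X (\<pi> j)) < 1" using lt1 by simp
    also have "(\<Prod>j<r. f X (\<pi> j)) = (1 / u X) ^ (\<Sum>j<r. ?I j) * b X ^ (card X * r)"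
      by (simp add: f_def prod.distrib power_sum power_mult)
    also have "\<dots> = u X powr (3 / 4 * real (card X * r) - real (\<Sum>j<r. ?I j))"
    proof -
      have "(1 / u X) ^ k = u X powr (- real k)" for k
        using u[OF X] by (simp add: powr_minus powr_realpow power_one_over inverse_eq_divide)
      moreover have "b X ^ k = u X powr (3 / 4 * real k)" for k
        using u[OF X] by (simp add: b_def powr_power mult.commute)
      ultimately show ?thesis using u[OF X] by (simp add: powr_add[symmetric])
    qed
    finally have lt: "u X powr (3 / 4 * real (card X * r) - real (\<Sum>j<r. ?I j)) < 1" .
    have "real (\<Sum>j<r. ?I j) < 3 / 4 * real (card X * r)"
    proof (rule ccontr)
      assume "\<not> ?thesis"
      then have "u X powr 0 \<le> u X powr (3 / 4 * real (card X * r) - real (\<Sum>j<r. ?I j))"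
        using u[OF X] by (intro powr_mono') auto
      then show False using lt u[OF X] by simp
    qed
    then have "(\<Sum>j<r. real (?I j)) < 3 / 4 * real (card X * r)" by simp
    moreover have "real (card {i \<in> X. \<pi> j i \<notin> X}) = real (card X) - real (?I j)" for j
    proof -
      have "card X = card {i \<in> X. \<pi> j i \<notin> X} + ?I j"
        using finX[OF X] by (subst card_Un_disjoint[symmetric]) (auto intro: arg_cong[of _ _ card])
      then show ?thesis by simp
    qed
    ultimately show ?thesis by (simp add: sum_subtractf mult_ac)
  qed
  show ?thesis
  proof (intro exI[of _ \<pi>] conjI allI impI)
    show "\<pi> j permutes {..<m}" for j using \<pi>[of j] by (simp add: P_def)
    fix X :: "nat set" assume "X \<subseteq> {..<m}" "2 * card X \<le> m"
    then show "real r * real (card X) / 4 \<le> (\<Sum>j<r. real (card {i \<in> X. \<pi> j i \<notin> X}))"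
      using main[of X] by (cases "X = {}") (auto simp: \<X>_def)
  qed
qed

lemma exists_expanding_permutations_cut:
  assumes r: "r \<ge> 124"
  shows "\<exists>\<pi> :: nat \<Rightarrow> nat \<Rightarrow> nat. (\<forall>j. \<pi> j permutes {..<m}) \<and>
           (\<forall>X. X \<subseteq> {..<m} \<longrightarrow> real r * real (min (card X) (m - card X)) / 4
              \<le> (\<Sum>j<r. real (card {i \<in> {..<m}. (i \<in> X) \<noteq> (\<pi> j i \<in> X)})))"
proof -
  obtain \<pi> :: "nat \<Rightarrow> nat \<Rightarrow> nat" where perm: "\<And>j. \<pi> j permutes {..<m}"
    and ex: "\<And>X. X \<subseteq> {..<m} \<Longrightarrow> 2 * card X \<le> m \<Longrightarrow>
      real r * real (card X) / 4 \<le> (\<Sum>j<r. real (card {i \<in> X. \<pi> j i \<notin> X}))"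
    using exists_expanding_permutations[OF r, of m] by blast
  show ?thesis
  proof (intro exI[of _ \<pi>] conjI allI impI)
    fix X assume X: "X \<subseteq> {..<m}"
    have fX: "finite X" using X finite_subset by blast
    show "real r * real (min (card X) (m - card X)) / 4
              \<le> (\<Sum>j<r. real (card {i \<in> {..<m}. (i \<in> X) \<noteq> (\<pi> j i \<in> X)}))"
    proof (cases "2 * card X \<le> m")
      case True
      have "(\<Sum>j<r. real (card {i \<in> X. \<pi> j i \<notin> X})) \<le>
            (\<Sum>j<r. real (card {i \<in> {..<m}. (i \<in> X) \<noteq> (\<pi> j i \<in> X)}))"
        using X by (intro sum_mono of_nat_mono card_mono) auto
      moreover have "min (card X) (m - card X) = card X" using True by simp
      ultimately show ?thesis using ex[OF X True] by simp
    next
      case False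
      let ?Y = "{..<m} - X"
      have c: "card ?Y = m - card X" using X fX by (simp add: card_Diff_subset)
      have "(\<Sum>j<r. real (card {i \<in> ?Y. \<pi> j i \<notin> ?Y})) \<le>
            (\<Sum>j<r. real (card {i \<in> {..<m}. (i \<in> X) \<noteq> (\<pi> j i \<in> X)}))"
      proof (intro sum_mono of_nat_mono card_mono)
        fix j
        have "\<pi> j i < m" if "i < m" for i using permutes_in_image[OF perm[of j], of i] that by simp
        then show "{i \<in> ?Y. \<pi> j i \<notin> ?Y} \<subseteq> {i \<in> {..<m}. (i \<in> X) \<noteq> (\<pi> j i \<in> X)}" by auto
      qed auto
      moreover have "min (card X) (m - card X) = card ?Y" using False c by simp
      moreover have "real r * real (card ?Y) / 4 \<le> (\<Sum>j<r. real (card {i \<in> ?Y. \<pi> j i \<notin> ?Y}))"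
        using False c by (intro ex) auto
      ultimately show ?thesis by (simp only: order_trans)
    qed
  qed (rule perm)
qed

section \<open>Exploring clusters under percolation\<close>

definition cluster_reach :: "('e \<Rightarrow> 'c set) \<Rightarrow> 'e set \<Rightarrow> 'c set \<Rightarrow> 'c set" where
  "cluster_reach en K A = {c. \<exists>a\<in>A. (\<lambda>x y. \<exists>e\<in>K. en e = {x, y})\<^sup>*\<^sup>* a c}"

lemma subset_cluster_reach: "A \<subseteq> cluster_reach en K A"
  unfolding cluster_reach_def by blast

lemma cluster_reach_step:
  assumes "x \<in> cluster_reach en K A" "e \<in> K" "en e = {x, y}"
  shows "y \<in> cluster_reach en K A"
  using assms unfolding cluster_reach_def by (auto intro: rtranclp.rtrancl_into_rtrancl)

lemma cluster_reach_least:
  assumes "A \<subseteq> R" and "\<And>e x y. e \<in> K \<Longrightarrow> en e = {x, y} \<Longrightarrow> x \<in> R \<Longrightarrow> y \<in> R"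
  shows "cluster_reach en K A \<subseteq> R"
proof
  fix c assume "c \<in> cluster_reach en K A"
  then obtain a where a: "a \<in> A" "(\<lambda>x y. \<exists>e\<in>K. en e = {x, y})\<^sup>*\<^sup>* a c"
    unfolding cluster_reach_def by blast
  from a(2) show "c \<in> R"
    by (induction rule: rtranclp_induct) (use a(1) assms in auto)
qed

lemma cluster_reach_insert_edge:
  assumes a: "a \<in> A" and e0: "en e0 = {a, w}"
  shows "cluster_reach en (insert e0 K) A = cluster_reach en K (insert w A)"
proof
  show "cluster_reach en (insert e0 K) A \<subseteq> cluster_reach en K (insert w A)"
  proof (rule cluster_reach_least)
    show "A \<subseteq> cluster_reach en K (insert w A)"
      using subset_cluster_reach[of "insert w A" en K] by blast
    fix e x y assume *: "e \<in> insert e0 K" "en e = {x, y}" "x \<in> cluster_reach en K (insert w A)"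
    show "y \<in> cluster_reach en K (insert w A)"
    proof (cases "e \<in> K")
      case True
      show ?thesis by (rule cluster_reach_step[OF *(3) True *(2)])
    next
      case False
      then have "y \<in> insert w A" using * a e0 by auto
      then show ?thesis using subset_cluster_reach[of "insert w A" en K] by blast
    qed
  qed
  show "cluster_reach en K (insert w A) \<subseteq> cluster_reach en (insert e0 K) A"
  proof (rule cluster_reach_least)
    have A: "A \<subseteq> cluster_reach en (insert e0 K) A" by (rule subset_cluster_reach)
    then have "w \<in> cluster_reach en (insert e0 K) A"
      using cluster_reach_step[of a en "insert e0 K" A e0 w] a e0 by blast
    with A show "insert w A \<subseteq> cluster_reach en (insert e0 K) A" by blast
    show "y \<in> cluster_reach en (insert e0 K) A"
      if "e \<in> K" "en e = {x, y}" "x \<in> cluster_reach en (insert e0 K) A" for e x y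
      using cluster_reach_step[OF that(3) _ that(2)] that(1) by blast
  qed
qed

text \<open>The edges are revealed one at a time, always picking an edge that leaves the set reached so
  far. Each unrevealed edge at this set contributes a factor \<open>q = 1 - p + p F\<close>, where \<open>F\<close> bounds the
  total weight of a newly reached cluster.\<close>
lemma expectation_power_cluster_reach_le:
  fixes p z F :: real
  assumes D: "finite D" and A: "finite A"
    and deg: "\<And>c. card {e \<in> D. c \<in> en e \<and> card (en e) = 2} \<le> k"
    and p: "0 \<le> p" "p \<le> 1" and z: "0 < z" and F: "1 \<le> F" "z * (1 - p + p * F) ^ k \<le> F"
  shows "measure_pmf.expectation (Pi_pmf D False (\<lambda>_. bernoulli_pmf p))
           (\<lambda>keep. z ^ card (cluster_reach en {e \<in> D. keep e} A))
         \<le> z ^ card A * (1 - p + p * F) ^ card {e \<in> D. en e \<inter> A \<noteq> {} \<and> card (en e) = 2}"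
  using D A deg
proof (induction "card D" arbitrary: D A rule: less_induct)
  case less
  define q where "q = 1 - p + p * F"
  have q1: "q \<ge> 1"
    using mult_left_mono[OF F(1) p(1)] by (simp add: q_def)
  show ?case
  proof (cases "\<exists>e\<in>D. \<exists>a\<in>A. \<exists>w. w \<notin> A \<and> en e = {a, w}")
    case False
    have "cluster_reach en {e \<in> D. keep e} A = A" for keep
    proof
      show "cluster_reach en {e \<in> D. keep e} A \<subseteq> A"
        by (rule cluster_reach_least) (use False in auto)
    qed (rule subset_cluster_reach)
    then show ?thesis
      using q1 z by (simp add: q_def[symmetric] mult_le_cancel_left1)
  next
    case True
    then obtain e a w where e: "e \<in> D" "a \<in> A" "w \<notin> A" "en e = {a, w}" by blast
    define D' where "D' = D - {e}"
    have D': "D = insert e D'" "e \<notin> D'" "finite D'" "card D' < card D"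
      using e less.prems card_Diff1_less[of D e] by (auto simp: D'_def)
    have c2: "card (en e) = 2" using e by (auto simp: card_2_iff)
    define b where "b = card {e \<in> D'. en e \<inter> A \<noteq> {} \<and> card (en e) = 2}"
    define M where "M = Pi_pmf D' False (\<lambda>_. bernoulli_pmf p)"
    define h where "h = (\<lambda>A keep. z ^ card (cluster_reach en {e \<in> D'. keep e} A))"
    have finM: "finite (set_pmf M)"
      unfolding M_def using D' by (intro finite_subset[OF set_Pi_pmf_subset'] finite_PiE_dflt) auto
    have b: "card {e \<in> D. en e \<inter> A \<noteq> {} \<and> card (en e) = 2} = Suc b"
    proof -
      have "{e \<in> D. en e \<inter> A \<noteq> {} \<and> card (en e) = 2} =
          insert e {e \<in> D'. en e \<inter> A \<noteq> {} \<and> card (en e) = 2}"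
        using D' e c2 by auto
      then show ?thesis using D' by (simp add: b_def)
    qed
    have deg': "card {e \<in> D'. c \<in> en e \<and> card (en e) = 2} \<le> k" for c
    proof -
      have "card {e \<in> D'. c \<in> en e \<and> card (en e) = 2} \<le> card {e \<in> D. c \<in> en e \<and> card (en e) = 2}"
        using less.prems D' by (intro card_mono) auto
      then show ?thesis using less.prems(3)[of c] by linarith
    qed
    have IH1: "measure_pmf.expectation M (h A) \<le> z ^ card A * q ^ b"
      unfolding M_def h_def b_def q_def using D' less.prems deg' by (intro less.hyps) auto
    have "measure_pmf.expectation M (h (insert w A)) \<le> z ^ card (insert w A) *
        q ^ card {e \<in> D'. en e \<inter> insert w A \<noteq> {} \<and> card (en e) = 2}"
      unfolding M_def h_def q_def using D' less.prems deg' by (intro less.hyps) auto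
    also have "\<dots> \<le> z ^ card (insert w A) * q ^ (b + k)"
    proof (intro mult_left_mono power_increasing)
      have "card {e \<in> D'. en e \<inter> insert w A \<noteq> {} \<and> card (en e) = 2} \<le>
          card ({e \<in> D'. en e \<inter> A \<noteq> {} \<and> card (en e) = 2} \<union> {e \<in> D'. w \<in> en e \<and> card (en e) = 2})"
        using D' by (intro card_mono) auto
      also have "\<dots> \<le> b + card {e \<in> D'. w \<in> en e \<and> card (en e) = 2}"
        unfolding b_def by (rule card_Un_le)
      finally show "card {e \<in> D'. en e \<inter> insert w A \<noteq> {} \<and> card (en e) = 2} \<le> b + k"
        using deg'[of w] by linarith
    qed (use q1 z in auto)
    also have "\<dots> = z ^ card A * q ^ b * (z * q ^ k)"
      using e less.prems by (simp add: power_add)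
    also have "\<dots> \<le> z ^ card A * q ^ b * F"
      using F z q1 by (intro mult_left_mono) (auto simp: q_def)
    finally have IH2: "measure_pmf.expectation M (h (insert w A)) \<le> z ^ card A * q ^ b * F" .
    have up: "cluster_reach en {e' \<in> D. (keep(e := y)) e'} A =
        cluster_reach en {e \<in> D'. keep e} (if y then insert w A else A)" for keep y
    proof (cases y)
      case True
      then have "{e' \<in> D. (keep(e := y)) e'} = insert e {e \<in> D'. keep e}"
        using D' by auto
      then show ?thesis using True cluster_reach_insert_edge[of a A en e w] e by simp
    next
      case False
      then have "{e' \<in> D. (keep(e := y)) e'} = {e \<in> D'. keep e}"
        using D' by auto
      then show ?thesis using False by simp
    qed
    have Pi_bind: "Pi_pmf D False (\<lambda>_. bernoulli_pmf p) =
        bernoulli_pmf p \<bind> (\<lambda>y. map_pmf (\<lambda>f. f(e := y)) M)"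
      unfolding D'(1) M_def map_pmf_def using D'(2,3) by (subst Pi_pmf_insert') auto
    have "measure_pmf.expectation (Pi_pmf D False (\<lambda>_. bernoulli_pmf p))
           (\<lambda>keep. z ^ card (cluster_reach en {e \<in> D. keep e} A)) =
         (\<Sum>y\<in>UNIV. pmf (bernoulli_pmf p) y *\<^sub>R measure_pmf.expectation (map_pmf (\<lambda>f. f(e := y)) M)
           (\<lambda>keep. z ^ card (cluster_reach en {e \<in> D. keep e} A)))"
      unfolding Pi_bind by (rule pmf_expectation_bind) (use finM in auto)
    also have "\<dots> = p * measure_pmf.expectation M (h (insert w A)) +
        (1 - p) * measure_pmf.expectation M (h A)"
      using p by (simp add: UNIV_bool up h_def del: fun_upd_apply)
    also have "\<dots> \<le> p * (z ^ card A * q ^ b * F) + (1 - p) * (z ^ card A * q ^ b)"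
      using p IH1 IH2 by (intro add_mono mult_left_mono) auto
    also have "\<dots> = z ^ card A * q ^ Suc b"
      by (simp add: q_def algebra_simps)
    finally show ?thesis unfolding b q_def .
  qed
qed

lemma component_of_subset_cluster_reach:
  assumes "u \<in> verts G"
  shows "component_of (verts G, K) u \<subseteq>
           {v \<in> verts G. cl v \<in> cluster_reach ((`) cl) K {cl u}}"
proof
  fix v assume "v \<in> component_of (verts G, K) u"
  then have v: "v \<in> verts G" "(\<lambda>x y. {x, y} \<in> K)\<^sup>*\<^sup>* u v"
    by (auto simp: component_of_def)
  from v(2) have "cl v \<in> cluster_reach ((`) cl) K {cl u}"
  proof (induction rule: rtranclp_induct)
    case base
    then show ?case using subset_cluster_reach[of "{cl u}"] by blast
  next
    case (step x y)
    show ?case by (rule cluster_reach_step[OF step.IH step.hyps(2)]) simp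
  qed
  with v show "v \<in> {v \<in> verts G. cl v \<in> cluster_reach ((`) cl) K {cl u}}" by blast
qed

lemma prob_large_component_le:
  fixes G :: "'a ugraph" and cl :: "'a \<Rightarrow> 'c" and p z F L :: real
  assumes G: "finite_simple_graph G"
    and size: "\<And>c. card {v \<in> verts G. cl v = c} \<le> s" and s: "0 < s"
    and deg: "\<And>c. card {e \<in> edges G. c \<in> cl ` e \<and> card (cl ` e) = 2} \<le> k"
    and p: "0 \<le> p" "p \<le> 1" and z: "1 < z" and F: "1 \<le> F" "z * (1 - p + p * F) ^ k \<le> F"
  shows "measure_pmf.prob (random_subgraph G p) {H. \<not> (\<forall>K\<in>graph_components H. real (card K) \<le> L)}
           \<le> card (cl ` verts G) * F / z powr (L / s)"
proof -
  define M where "M = Pi_pmf (edges G) False (\<lambda>_. bernoulli_pmf p)"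
  define R where "R = (\<lambda>c keep. cluster_reach ((`) cl) {e \<in> edges G. keep e} {c})"
  have fV: "finite (verts G)" and ev: "\<And>e. e \<in> edges G \<Longrightarrow> e \<subseteq> verts G"
    using G by (auto simp: finite_simple_graph_def)
  have fE: "finite (edges G)" by (rule finite_subset[of _ "Pow (verts G)"]) (use fV ev in auto)
  have finM: "finite (set_pmf M)"
    unfolding M_def using fE by (intro finite_subset[OF set_Pi_pmf_subset'] finite_PiE_dflt) auto
  have tail: "measure_pmf.prob M {keep. z powr (L / s) \<le> z ^ card (R c keep)} \<le> F / z powr (L / s)" for c
  proof -
    have q1: "1 \<le> 1 - p + p * F"
      using mult_left_mono[OF F(1) p(1)] by simp
    have "measure_pmf.expectation M (\<lambda>keep. z ^ card (R c keep)) \<le>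
        z ^ card {c} * (1 - p + p * F) ^ card {e \<in> edges G. cl ` e \<inter> {c} \<noteq> {} \<and> card (cl ` e) = 2}"
      unfolding M_def R_def
      by (rule expectation_power_cluster_reach_le) (use fE deg p z F in auto)
    also have "\<dots> \<le> z * (1 - p + p * F) ^ k"
      using z q1 deg[of c] by (auto intro!: power_increasing)
    also have "\<dots> \<le> F" by (rule F)
    finally have "measure_pmf.expectation M (\<lambda>keep. z ^ card (R c keep)) \<le> F" .
    moreover have "measure_pmf.prob M {keep \<in> space M. z powr (L / s) \<le> z ^ card (R c keep)} \<le>
        measure_pmf.expectation M (\<lambda>keep. z ^ card (R c keep)) / z powr (L / s)"
      by (rule integral_Markov_inequality_measure[where A = "{}"])
        (use z in \<open>auto intro: integrable_measure_pmf_finite finM\<close>)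
    moreover have "measure_pmf.expectation M (\<lambda>keep. z ^ card (R c keep)) / z powr (L / s) \<le>
        F / z powr (L / s)"
      using calculation by (intro divide_right_mono) auto
    ultimately show ?thesis by simp
  qed
  have sub: "(\<lambda>keep. (verts G, {e \<in> edges G. keep e})) -` {H. \<not> (\<forall>K\<in>graph_components H. real (card K) \<le> L)}
      \<subseteq> (\<Union>c\<in>cl ` verts G. {keep. z powr (L / s) \<le> z ^ card (R c keep)})"
  proof
    fix keep
    assume "keep \<in> (\<lambda>keep. (verts G, {e \<in> edges G. keep e})) -`
       {H. \<not> (\<forall>K\<in>graph_components H. real (card K) \<le> L)}"
    then obtain u where u: "u \<in> verts G"
      "L < card (component_of (verts G, {e \<in> edges G. keep e}) u)"
      by (auto simp: graph_components_def not_le)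
    let ?R = "R (cl u) keep"
    have "?R \<subseteq> cl ` verts G"
      unfolding R_def
    proof (rule cluster_reach_least)
      fix e x y assume "e \<in> {e \<in> edges G. keep e}" "cl ` e = {x, y}"
      then show "y \<in> cl ` verts G" using ev[of e] by blast
    qed (use u in auto)
    then have fR: "finite ?R" using fV finite_subset by blast
    have "card (component_of (verts G, {e \<in> edges G. keep e}) u) \<le> card {v \<in> verts G. cl v \<in> ?R}"
      unfolding R_def using u fV by (intro card_mono component_of_subset_cluster_reach) auto
    also have "{v \<in> verts G. cl v \<in> ?R} = (\<Union>c\<in>?R. {v \<in> verts G. cl v = c})" by auto
    also have "card \<dots> \<le> (\<Sum>c\<in>?R. card {v \<in> verts G. cl v = c})"
      by (rule card_UN_le) (rule fR)
    also have "\<dots> \<le> (\<Sum>c\<in>?R. s)" by (intro sum_mono size)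
    finally have "card (component_of (verts G, {e \<in> edges G. keep e}) u) \<le> card ?R * s" by simp
    then have "real (card (component_of (verts G, {e \<in> edges G. keep e}) u)) \<le> real (card ?R * s)"
      by (simp only: of_nat_le_iff)
    then have "L / s \<le> card ?R" using u s by (simp add: field_simps)
    then have "z powr (L / s) \<le> z powr (card ?R)" using z by (intro powr_mono) auto
    then have "z powr (L / s) \<le> z ^ card ?R" using z by (simp add: powr_realpow)
    then show "keep \<in> (\<Union>c\<in>cl ` verts G. {keep. z powr (L / s) \<le> z ^ card (R c keep)})"
      using u by blast
  qed
  have "measure_pmf.prob (random_subgraph G p) {H. \<not> (\<forall>K\<in>graph_components H. real (card K) \<le> L)} \<le>
      measure_pmf.prob M (\<Union>c\<in>cl ` verts G. {keep. z powr (L / s) \<le> z ^ card (R c keep)})"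
    unfolding random_subgraph_def M_def[symmetric] measure_map_pmf
    by (rule measure_pmf.finite_measure_mono[OF sub]) simp
  also have "\<dots> \<le> (\<Sum>c\<in>cl ` verts G. measure_pmf.prob M {keep. z powr (L / s) \<le> z ^ card (R c keep)})"
    using fV by (intro measure_pmf.finite_measure_subadditive_finite) auto
  also have "\<dots> \<le> (\<Sum>c\<in>cl ` verts G. F / z powr (L / s))"
    by (intro sum_mono tail)
  finally show ?thesis by simp
qed

section \<open>Clusters rewired along permutations\<close>

lemma vertex_degree_adjacency:
  assumes sym: "\<And>x y. adj x y \<Longrightarrow> adj y x" and irr: "\<And>x. \<not> adj x x" and v: "v \<in> V"
  shows "vertex_degree (V, {{x, y} |x y. x \<in> V \<and> y \<in> V \<and> adj x y}) v = card {y \<in> V. adj v y}"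
proof -
  let ?E = "{{x, y} |x y. x \<in> V \<and> y \<in> V \<and> adj x y}"
  have "{e \<in> ?E. v \<in> e} = (\<lambda>y. {v, y}) ` {y \<in> V. adj v y}"
  proof (intro subset_antisym subsetI)
    fix e assume "e \<in> {e \<in> ?E. v \<in> e}"
    then obtain x y where e: "e = {x, y}" "x \<in> V" "y \<in> V" "adj x y" "v \<in> e" by blast
    then consider "v = x" | "v = y" by blast
    then show "e \<in> (\<lambda>y. {v, y}) ` {y \<in> V. adj v y}"
    proof cases
      case 1
      then show ?thesis using e by blast
    next
      case 2
      then have "e = {v, x}" "adj v x" using e sym by auto
      then show ?thesis using e by blast
    qed
  qed (use v in blast)
  moreover have "inj_on (\<lambda>y. {v, y}) {y \<in> V. adj v y}"
    by (rule inj_onI) (auto simp: doubleton_eq_iff)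
  ultimately show ?thesis by (simp add: vertex_degree_def card_image)
qed

lemma card_relation_le:
  assumes "finite P" and "\<And>x. x \<in> P \<Longrightarrow> card {y \<in> Q. R x y} \<le> k" and "finite Q"
  shows "card {(x, y). x \<in> P \<and> y \<in> Q \<and> R x y} \<le> k * card P"
proof -
  have "{(x, y). x \<in> P \<and> y \<in> Q \<and> R x y} = Sigma P (\<lambda>x. {y \<in> Q. R x y})" by auto
  then have "card {(x, y). x \<in> P \<and> y \<in> Q \<and> R x y} = (\<Sum>x\<in>P. card {y \<in> Q. R x y})"
    using assms by simp
  also have "\<dots> \<le> (\<Sum>x\<in>P. k)" using assms by (intro sum_mono) auto
  finally show ?thesis by (simp add: mult.commute)
qed

definition vx :: "nat \<Rightarrow> nat \<Rightarrow> nat" where "vx i a = prod_encode (i, a)"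
definition cluster_of :: "nat \<Rightarrow> nat" where "cluster_of v = fst (prod_decode v)"
definition position_of :: "nat \<Rightarrow> nat" where "position_of v = snd (prod_decode v)"

lemma cluster_of_vx [simp]: "cluster_of (vx i a) = i"
  and position_of_vx [simp]: "position_of (vx i a) = a"
  and vx_cluster_position [simp]: "vx (cluster_of v) (position_of v) = v"
  by (simp_all add: vx_def cluster_of_def position_of_def)

lemma vx_eqI: "cluster_of v = i \<Longrightarrow> position_of v = a \<Longrightarrow> v = vx i a"
  by auto

lemma vx_inject [simp]: "vx i a = vx j b \<longleftrightarrow> i = j \<and> a = b"
  by (metis cluster_of_vx position_of_vx)

locale rewired_clusters =
  fixes m r d :: nat and s :: "nat \<Rightarrow> nat" and \<pi> :: "nat \<Rightarrow> nat \<Rightarrow> nat"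
  assumes perm: "\<And>j. \<pi> j permutes {..<m}"
    and size: "\<And>i. s i = d + 1 \<or> s i = d + 3"
    and r_le: "2 * r \<le> d" and d_ge: "11 \<le> d"
begin

definition half :: "nat \<Rightarrow> nat" where "half i = s i div 2"

lemma half_bounds: "r \<le> half i" "2 * half i \<le> s i" "s i \<le> Suc (2 * half i)" "2 \<le> half i"
  using size[of i] r_le d_ge unfolding half_def by auto

definition rung :: "nat \<Rightarrow> nat \<Rightarrow> nat \<Rightarrow> bool" where
  "rung i a b \<longleftrightarrow> a < r \<and> b = half i + a"

definition cycle_step :: "nat \<Rightarrow> nat \<Rightarrow> nat \<Rightarrow> bool" where
  "cycle_step i a b \<longleftrightarrow> s i = d + 3 \<and> b = Suc a mod s i"

definition removed :: "nat \<Rightarrow> nat \<Rightarrow> nat \<Rightarrow> bool" where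
  "removed i a b \<longleftrightarrow> rung i a b \<or> rung i b a \<or> cycle_step i a b \<or> cycle_step i b a"

text \<open>A fixed point of \<open>\<pi> j\<close> merely restores the rung that was removed, so no multiple edges arise.\<close>
definition bridge :: "nat \<Rightarrow> nat \<Rightarrow> bool" where
  "bridge x y \<longleftrightarrow> position_of x < r \<and> cluster_of y = \<pi> (position_of x) (cluster_of x) \<and>
     position_of y = half (cluster_of y) + position_of x"

definition adj :: "nat \<Rightarrow> nat \<Rightarrow> bool" where
  "adj x y \<longleftrightarrow> cluster_of x = cluster_of y \<and> x \<noteq> y \<and>
       \<not> removed (cluster_of x) (position_of x) (position_of y) \<or> bridge x y \<or> bridge y x"

definition V :: "nat set" where
  "V = {v. cluster_of v < m \<and> position_of v < s (cluster_of v)}"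

definition E :: "nat set set" where
  "E = {{x, y} |x y. x \<in> V \<and> y \<in> V \<and> adj x y}"

lemma removed_sym: "removed i a b \<longleftrightarrow> removed i b a"
  unfolding removed_def by blast

lemma adj_sym: "adj x y \<Longrightarrow> adj y x"
  unfolding adj_def using removed_sym by metis

lemma not_bridge_refl: "\<not> bridge x x"
  using half_bounds(4)[of "cluster_of x"] unfolding bridge_def by auto

lemma adj_irrefl: "\<not> adj x x"
  unfolding adj_def using not_bridge_refl by blast

lemma V_eq: "V = (\<lambda>(i, a). vx i a) ` Sigma {..<m} (\<lambda>i. {..<s i})"
proof (intro subset_antisym subsetI)
  fix v assume "v \<in> V"
  then show "v \<in> (\<lambda>(i, a). vx i a) ` Sigma {..<m} (\<lambda>i. {..<s i})"
    by (intro image_eqI[of _ _ "(cluster_of v, position_of v)"]) (auto simp: V_def)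
qed (auto simp: V_def)

lemma finite_V: "finite V"
  unfolding V_eq by auto

lemma card_V: "card V = (\<Sum>i<m. s i)"
  unfolding V_eq by (subst card_image) (auto simp: inj_on_def)

lemma cluster_eq: "i < m \<Longrightarrow> {v \<in> V. cluster_of v = i} = vx i ` {..<s i}"
  by (auto simp: V_def intro!: image_eqI[of _ "vx _" "position_of _"])

lemma card_cluster: "i < m \<Longrightarrow> card {v \<in> V. cluster_of v = i} = s i"
  by (simp add: cluster_eq card_image inj_on_def)

lemma card_cluster_le: "card {v \<in> V. cluster_of v = i} \<le> d + 3"
proof (cases "i < m")
  case True
  then show ?thesis using card_cluster[OF True] size[of i] by auto
next
  case False
  then have "{v \<in> V. cluster_of v = i} = {}" by (auto simp: V_def)
  then show ?thesis by (simp only: card.empty)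
qed

lemma finite_simple_graph_VE: "finite_simple_graph (V, E)"
  unfolding finite_simple_graph_def
proof (intro conjI ballI)
  fix e assume "e \<in> edges (V, E)"
  then obtain x y where e: "e = {x, y}" "x \<in> V" "y \<in> V" "adj x y" by (auto simp: E_def)
  moreover from e have "x \<noteq> y" using adj_irrefl by blast
  ultimately show "e \<subseteq> verts (V, E)" "card e = 2" by auto
qed (simp add: finite_V)

lemma perm_lt: "i < m \<Longrightarrow> \<pi> j i < m"
  using permutes_in_image[OF perm, of j i] by simp

lemma perm_inv_lt: "i < m \<Longrightarrow> inv (\<pi> j) i < m"
  using permutes_in_image[OF permutes_inv[OF perm], of j i] by simp

lemma perm_eq_iff: "\<pi> j i = \<pi> j i' \<longleftrightarrow> i = i'"
  using permutes_inj[OF perm, of j] by (auto dest: injD)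

lemma vx_in_V_iff: "vx i a \<in> V \<longleftrightarrow> i < m \<and> a < s i"
  by (simp add: V_def)

lemma card_rungs_eq_card_bridges:
  assumes x: "x \<in> V"
  defines "i \<equiv> cluster_of x" and "a \<equiv> position_of x"
  shows "card {b. b < s i \<and> (rung i a b \<or> rung i b a)} = card {y \<in> V. bridge x y \<or> bridge y x}"
proof -
  have im: "i < m" and a: "a < s i" using x by (auto simp: V_def i_def a_def)
  note hb = half_bounds
  consider "a < r" | "half i \<le> a" "a < half i + r" | "\<not> a < r" "\<not> (half i \<le> a \<and> a < half i + r)"
    by blast
  then show ?thesis
  proof cases
    case 1
    have "{b. b < s i \<and> (rung i a b \<or> rung i b a)} = {half i + a}"
      using 1 hb[of i] by (auto simp: rung_def)
    moreover have "{y \<in> V. bridge x y \<or> bridge y x} = {vx (\<pi> a i) (half (\<pi> a i) + a)}"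
    proof -
      have "\<not> bridge y x" for y
        using 1 hb(1)[of i] by (auto simp: bridge_def i_def a_def)
      moreover have "bridge x y \<longleftrightarrow> y = vx (\<pi> a i) (half (\<pi> a i) + a)" for y
        using 1 by (auto simp: bridge_def i_def[symmetric] a_def[symmetric] intro: vx_eqI)
      moreover have "vx (\<pi> a i) (half (\<pi> a i) + a) \<in> V"
        using 1 perm_lt[OF im] hb[of "\<pi> a i"] by (auto simp: vx_in_V_iff)
      ultimately show ?thesis by auto
    qed
    ultimately show ?thesis by simp
  next
    case 2
    have "{b. b < s i \<and> (rung i a b \<or> rung i b a)} = {a - half i}"
      using 2 hb[of i] a by (auto simp: rung_def)
    moreover have "{y \<in> V. bridge x y \<or> bridge y x} = {vx (inv (\<pi> (a - half i)) i) (a - half i)}"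
    proof -
      have "\<not> bridge x y" for y
        using 2 hb(1)[of i] by (auto simp: bridge_def i_def a_def)
      moreover have "bridge y x \<longleftrightarrow> y = vx (inv (\<pi> (a - half i)) i) (a - half i)" for y
      proof
        assume b: "bridge y x"
        then have p: "position_of y = a - half i" "i = \<pi> (a - half i) (cluster_of y)"
          by (auto simp: bridge_def i_def[symmetric] a_def[symmetric])
        then have "cluster_of y = inv (\<pi> (a - half i)) i"
          using permutes_inverses(2)[OF perm] by metis
        then show "y = vx (inv (\<pi> (a - half i)) i) (a - half i)"
          using p by (intro vx_eqI)
      next
        assume "y = vx (inv (\<pi> (a - half i)) i) (a - half i)"
        then show "bridge y x"
          using 2 permutes_inverses(1)[OF perm]
          by (auto simp: bridge_def i_def[symmetric] a_def[symmetric])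
      qed
      moreover have "vx (inv (\<pi> (a - half i)) i) (a - half i) \<in> V"
        using 2 perm_inv_lt[OF im, of "a - half i"] hb[of "inv (\<pi> (a - half i)) i"]
        by (auto simp: vx_in_V_iff)
      ultimately show ?thesis by auto
    qed
    ultimately show ?thesis by simp
  next
    case 3
    have "{b. b < s i \<and> (rung i a b \<or> rung i b a)} = {}"
      using 3 by (auto simp: rung_def)
    moreover have "{y \<in> V. bridge x y \<or> bridge y x} = {}"
      using 3 by (auto simp: bridge_def i_def[symmetric] a_def[symmetric])
    ultimately show ?thesis by (simp only:)
  qed
qed

lemma cycle_neighbours:
  assumes a: "a < s i" and si: "s i = d + 3"
  shows "{b. b < s i \<and> (cycle_step i a b \<or> cycle_step i b a)} =
      {if a = s i - 1 then 0 else a + 1, if a = 0 then s i - 1 else a - 1}"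
proof -
  have S: "Suc b mod s i = (if b = s i - 1 then 0 else b + 1)" if "b < s i" for b
    using that by auto
  have "b < s i \<and> (cycle_step i a b \<or> cycle_step i b a) \<longleftrightarrow>
     b = (if a = s i - 1 then 0 else a + 1) \<or> b = (if a = 0 then s i - 1 else a - 1)" for b
    unfolding cycle_step_def using a si S[of a] S[of b] by (auto split: if_splits)
  then show ?thesis by auto
qed

lemma card_cycle_neighbours:
  assumes a: "a < s i"
  shows "card {b. b < s i \<and> (cycle_step i a b \<or> cycle_step i b a)} = s i - (d + 1)"
proof (cases "s i = d + 3")
  case True
  then show ?thesis unfolding cycle_neighbours[OF a True] using d_ge a by auto
next
  case False
  then show ?thesis using size[of i] by (auto simp: cycle_step_def)
qed

lemma card_rungs_le: "card {b. b < s i \<and> (rung i a b \<or> rung i b a)} \<le> 1"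
proof -
  have "{b. b < s i \<and> (rung i a b \<or> rung i b a)} \<subseteq> {if a < r then half i + a else a - half i}"
    using half_bounds[of i] by (auto simp: rung_def)
  then show ?thesis using card_mono[of "{if a < r then half i + a else a - half i}"] by fastforce
qed

lemma card_removed:
  assumes a: "a < s i"
  shows "card {b. b < s i \<and> removed i a b} =
     card {b. b < s i \<and> (rung i a b \<or> rung i b a)} + (s i - (d + 1))"
proof -
  let ?R = "{b. b < s i \<and> (rung i a b \<or> rung i b a)}"
  let ?C = "{b. b < s i \<and> (cycle_step i a b \<or> cycle_step i b a)}"
  have "?R \<inter> ?C = {}"
  proof (cases "s i = d + 3")
    case True
    show ?thesis unfolding cycle_neighbours[OF a True]
      using half_bounds[of i] a True d_ge r_le by (auto simp: rung_def split: if_splits)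
  next
    case False
    then show ?thesis by (auto simp: cycle_step_def)
  qed
  moreover have "{b. b < s i \<and> removed i a b} = ?R \<union> ?C"
    by (auto simp: removed_def)
  ultimately show ?thesis
    using card_cycle_neighbours[OF a] by (simp add: card_Un_disjoint)
qed

lemma card_removed_le: "a < s i \<Longrightarrow> card {b. b < s i \<and> removed i a b} \<le> 3"
  using card_removed[of a i] card_rungs_le[of i a] size[of i] by auto

lemma not_removed_refl: "a < s i \<Longrightarrow> \<not> removed i a a"
  using half_bounds[of i] d_ge size[of i]
  by (auto simp: removed_def rung_def cycle_step_def mod_if split: if_splits)

lemma card_adj:
  assumes x: "x \<in> V"
  shows "card {y \<in> V. adj x y} = d"
proof -
  define i a where "i = cluster_of x" and "a = position_of x"
  have im: "i < m" and a: "a < s i" and xe: "x = vx i a"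
    using x by (auto simp: V_def i_def a_def)
  let ?B = "{b. b < s i \<and> removed i a b}"
  let ?I = "{y \<in> V. cluster_of x = cluster_of y \<and> x \<noteq> y \<and>
       \<not> removed (cluster_of x) (position_of x) (position_of y)}"
  let ?O = "{y \<in> V. bridge x y \<or> bridge y x}"
  have "?I = vx i ` ({..<s i} - {a} - ?B)"
    using im by (auto simp: xe V_def intro!: image_eqI[of _ "vx _" "position_of _"])
  then have "card ?I = card ({..<s i} - {a} - ?B)"
    by (simp add: card_image inj_on_def)
  also have "\<dots> = card ({..<s i} - {a}) - card ?B"
    using not_removed_refl[OF a] by (intro card_Diff_subset) auto
  also have "\<dots> = s i - 1 - card ?B" using a by simp
  finally have cI: "card ?I = s i - 1 - card ?B" .
  have "?I \<inter> ?O = {}"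
    by (auto simp: bridge_def removed_def rung_def)
  moreover have "{y \<in> V. adj x y} = ?I \<union> ?O" by (auto simp: adj_def)
  ultimately have "card {y \<in> V. adj x y} = card ?I + card ?O"
    using finite_V by (simp add: card_Un_disjoint)
  also have "card ?O = card {b. b < s i \<and> (rung i a b \<or> rung i b a)}"
    using card_rungs_eq_card_bridges[OF x] by (simp add: i_def a_def)
  finally show ?thesis
    using cI card_removed[OF a] card_rungs_le[of i a] size[of i] d_ge by auto
qed

lemma regular_VE: "regular_graph d (V, E)"
  unfolding regular_graph_def E_def
  using vertex_degree_adjacency[of adj _ V] adj_sym adj_irrefl card_adj by simp

lemma card_leaving_edges_le:
  "card {e \<in> E. c \<in> cluster_of ` e \<and> card (cluster_of ` e) = 2} \<le> 2 * r"
proof -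
  let ?out = "\<lambda>j. {vx c j, vx (\<pi> j c) (half (\<pi> j c) + j)}"
  let ?in = "\<lambda>j. {vx (inv (\<pi> j) c) j, vx c (half c + j)}"
  have "{e \<in> E. c \<in> cluster_of ` e \<and> card (cluster_of ` e) = 2} \<subseteq> ?out ` {..<r} \<union> ?in ` {..<r}"
  proof
    fix e assume "e \<in> {e \<in> E. c \<in> cluster_of ` e \<and> card (cluster_of ` e) = 2}"
    then obtain x y where e: "e = {x, y}" "adj x y" "c \<in> cluster_of ` e" "card (cluster_of ` e) = 2"
      by (auto simp: E_def)
    then have "cluster_of x \<noteq> cluster_of y" by auto
    then have "bridge x y \<or> bridge y x" using e by (auto simp: adj_def)
    then obtain x y where e: "e = {x, y}" "bridge x y" "c \<in> cluster_of ` e"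
      using e by (metis insert_commute)
    define j where "j = position_of x"
    have j: "j < r" "cluster_of y = \<pi> j (cluster_of x)" "position_of y = half (cluster_of y) + j"
      using e by (auto simp: bridge_def j_def)
    show "e \<in> ?out ` {..<r} \<union> ?in ` {..<r}"
    proof (cases "c = cluster_of x")
      case True
      then have "x = vx c j" "y = vx (\<pi> j c) (half (\<pi> j c) + j)"
        using j by (auto simp: j_def intro!: vx_eqI)
      then have "e = ?out j" using e by simp
      then show ?thesis using j by blast
    next
      case False
      then have "c = cluster_of y" using e by auto
      then have "x = vx (inv (\<pi> j) c) j" "y = vx c (half c + j)"
        using j permutes_inverses(2)[OF perm] by (auto simp: j_def intro!: vx_eqI)
      then have "e = ?in j" using e by simp
      then show ?thesis using j by blast
    qed
  qed
  then have "card {e \<in> E. c \<in> cluster_of ` e \<and> card (cluster_of ` e) = 2} \<le>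
      card (?out ` {..<r} \<union> ?in ` {..<r})"
    by (intro card_mono) auto
  also have "\<dots> \<le> card (?out ` {..<r}) + card (?in ` {..<r})" by (rule card_Un_le)
  also have "\<dots> \<le> r + r"
    using card_image_le[of "{..<r}" ?out] card_image_le[of "{..<r}" ?in] by simp
  finally show ?thesis by simp
qed


definition slice :: "nat set \<Rightarrow> nat \<Rightarrow> nat set" where
  "slice S i = {v \<in> S. cluster_of v = i}"

definition minority :: "nat set \<Rightarrow> nat \<Rightarrow> nat" where
  "minority S i = min (card (slice S i)) (s i - card (slice S i))"

definition majority_clusters :: "nat set \<Rightarrow> nat set" where
  "majority_clusters S = {i. i < m \<and> s i < 2 * card (slice S i)}"

lemma finite_slice: "S \<subseteq> V \<Longrightarrow> finite (slice S i)"
  unfolding slice_def using finite_subset[OF _ finite_V] by auto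

lemma slice_subset: "S \<subseteq> V \<Longrightarrow> slice S i \<subseteq> slice V i"
  unfolding slice_def by auto

lemma card_slice_V: "i < m \<Longrightarrow> card (slice V i) = s i"
  unfolding slice_def by (rule card_cluster)

lemma card_slice_le: "S \<subseteq> V \<Longrightarrow> i < m \<Longrightarrow> card (slice S i) \<le> s i"
  using card_mono[OF finite_slice[OF order_refl] slice_subset] card_slice_V by metis

lemma card_slice_Diff:
  "S \<subseteq> V \<Longrightarrow> i < m \<Longrightarrow> card (slice V i - S) = s i - card (slice S i)"
proof -
  assume S: "S \<subseteq> V" and i: "i < m"
  have "slice V i - S = slice V i - slice S i" by (auto simp: slice_def)
  then show ?thesis
    using card_Diff_subset[OF finite_slice[OF S] slice_subset[OF S]] card_slice_V[OF i] by simp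
qed

lemma sum_card_slices:
  assumes "T \<subseteq> V"
  shows "card T = (\<Sum>i<m. card (slice T i))"
proof -
  have "T = (\<Union>i<m. slice T i)" using assms by (auto simp: slice_def V_def)
  moreover have "card (\<Union>i<m. slice T i) = (\<Sum>i<m. card (slice T i))"
    using finite_slice[OF assms] by (intro card_UN_disjoint) (auto simp: slice_def)
  ultimately show ?thesis by simp
qed

definition inner_cut :: "nat set \<Rightarrow> nat \<Rightarrow> nat set set" where
  "inner_cut S i = {{x, y} |x y. x \<in> slice S i \<and> y \<in> slice V i - S \<and>
      \<not> removed i (position_of x) (position_of y)}"

lemma card_removed_partners_le:
  assumes "x \<in> slice V i"
  shows "card {y \<in> slice V i. removed i (position_of x) (position_of y)} \<le> 3"
proof -
  have x: "position_of x < s i" using assms by (auto simp: slice_def V_def)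
  have "card {y \<in> slice V i. removed i (position_of x) (position_of y)} \<le>
      card {b. b < s i \<and> removed i (position_of x) b}"
  proof (rule card_inj_on_le)
    show "inj_on position_of {y \<in> slice V i. removed i (position_of x) (position_of y)}"
      by (rule inj_onI) (metis (mono_tags, lifting) mem_Collect_eq slice_def vx_cluster_position)
  qed (auto simp: slice_def V_def)
  then show ?thesis using card_removed_le[OF x] by linarith
qed

lemma card_inner_cut:
  assumes S: "S \<subseteq> V" and i: "i < m"
  shows "real (minority S i) * ((real d - 5) / 2) \<le> real (card (inner_cut S i))"
proof -
  let ?A = "slice S i" and ?B = "slice V i - S"
  let ?R = "\<lambda>x y. removed i (position_of x) (position_of y)"
  let ?bad = "{(x, y). x \<in> ?A \<and> y \<in> ?B \<and> ?R x y}"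
  define a b where "a = card ?A" and "b = card ?B"
  have fA: "finite ?A" and fB: "finite ?B"
    using finite_slice[OF S] finite_slice[OF order_refl] by auto
  have ab: "a + b = s i" "minority S i = min a b"
    using card_slice_Diff[OF S i] card_slice_le[OF S i]
    by (auto simp: a_def b_def minority_def)
  have le3: "card {y \<in> Z. ?R x y} \<le> 3" if "x \<in> slice V i" "Z \<subseteq> slice V i" for x Z
    using card_mono[of "{y \<in> slice V i. ?R x y}" "{y \<in> Z. ?R x y}"]
      card_removed_partners_le[OF that(1)] that(2) finite_slice[OF order_refl, of i] by fastforce
  have "card ?bad \<le> 3 * a"
    unfolding a_def
    by (rule card_relation_le[OF fA _ fB], rule le3) (use slice_subset[OF S] in auto)
  moreover have "card ?bad \<le> 3 * b"
  proof -
    have "card {(y, x). y \<in> ?B \<and> x \<in> ?A \<and> ?R y x} \<le> 3 * b"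
      unfolding b_def
      by (rule card_relation_le[OF fB _ fA], rule le3) (use slice_subset[OF S] in auto)
    moreover have "card ?bad = card {(y, x). y \<in> ?B \<and> x \<in> ?A \<and> ?R y x}"
      by (rule bij_betw_same_card[of prod.swap])
        (auto simp: bij_betw_def inj_on_def image_def removed_sym)
    ultimately show ?thesis by simp
  qed
  ultimately have bad: "card ?bad \<le> 3 * min a b" by simp
  have "inner_cut S i = (\<lambda>(x, y). {x, y}) ` (?A \<times> ?B - ?bad)"
    by (auto simp: inner_cut_def image_def)
  moreover have "inj_on (\<lambda>(x, y). {x, y}) (?A \<times> ?B - ?bad)"
  proof (rule inj_onI)
    fix p q
    assume p: "p \<in> ?A \<times> ?B - ?bad" and q: "q \<in> ?A \<times> ?B - ?bad"
      and eq: "(case p of (x, y) \<Rightarrow> {x, y}) = (case q of (x, y) \<Rightarrow> {x, y})"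
    obtain x y x' y' where pq: "p = (x, y)" "q = (x', y')" by (cases p, cases q)
    have "x \<in> S" "x' \<in> S" "y \<notin> S" "y' \<notin> S" using p q pq by (auto simp: slice_def)
    moreover have "{x, y} = {x', y'}" using eq pq by simp
    ultimately have "x = x'" "y = y'" by (auto simp: doubleton_eq_iff)
    then show "p = q" using pq by simp
  qed
  ultimately have "card (inner_cut S i) = card (?A \<times> ?B - ?bad)" by (simp add: card_image)
  also have "\<dots> = a * b - card ?bad"
  proof (subst card_Diff_subset)
    show "finite ?bad" by (rule finite_subset[of _ "?A \<times> ?B"]) (use fA fB in auto)
  qed (auto simp: a_def b_def card_cartesian_product)
  finally have "a * b \<le> card (inner_cut S i) + 3 * min a b" using bad by linarith
  then have "real (a * b) \<le> real (card (inner_cut S i) + 3 * min a b)"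
    by (simp only: of_nat_le_iff)
  then have 1: "real a * real b - 3 * real (min a b) \<le> real (card (inner_cut S i))" by simp
  have "real (min a b) * (real (s i) / 2) \<le> real (min a b) * real (max a b)"
    using ab by (intro mult_left_mono) auto
  also have "\<dots> = real a * real b" by (simp add: min_def max_def mult.commute)
  finally have "real (min a b) * (real (s i) / 2 - 3) \<le> real (card (inner_cut S i))"
    using 1 by (simp add: algebra_simps)
  moreover have "real (min a b) * ((real d - 5) / 2) \<le> real (min a b) * (real (s i) / 2 - 3)"
    using size[of i] by (intro mult_left_mono) auto
  ultimately show ?thesis using ab by simp
qed

lemma card_misplaced:
  assumes S: "S \<subseteq> V"
  shows "card {v \<in> V. (v \<in> S) \<noteq> (cluster_of v \<in> majority_clusters S)} = (\<Sum>i<m. minority S i)"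
proof -
  let ?D = "{v \<in> V. (v \<in> S) \<noteq> (cluster_of v \<in> majority_clusters S)}"
  have "card ?D = (\<Sum>i<m. card (slice ?D i))" by (rule sum_card_slices) auto
  also have "\<dots> = (\<Sum>i<m. minority S i)"
  proof (rule sum.cong[OF refl])
    fix i assume "i \<in> {..<m}"
    then have i: "i < m" by simp
    show "card (slice ?D i) = minority S i"
    proof (cases "i \<in> majority_clusters S")
      case True
      then have "slice ?D i = slice V i - S" by (auto simp: slice_def)
      then show ?thesis using True card_slice_Diff[OF S i]
        by (auto simp: minority_def majority_clusters_def)
    next
      case False
      then have "slice ?D i = slice S i" using S by (auto simp: slice_def)
      then show ?thesis using False i by (auto simp: minority_def majority_clusters_def)
    qed
  qed
  finally show ?thesis .
qed

definition tail_end :: "nat \<times> nat \<Rightarrow> nat" where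
  "tail_end = (\<lambda>(j, i). vx i j)"

definition head_end :: "nat \<times> nat \<Rightarrow> nat" where
  "head_end = (\<lambda>(j, i). vx (\<pi> j i) (half (\<pi> j i) + j))"

lemma ends_in_V:
  assumes "j < r" "i < m"
  shows "tail_end (j, i) \<in> V" "head_end (j, i) \<in> V" "bridge (tail_end (j, i)) (head_end (j, i))"
  using assms half_bounds[of i] half_bounds[of "\<pi> j i"] perm_lt[OF assms(2), of j]
  by (auto simp: tail_end_def head_end_def vx_in_V_iff bridge_def)

lemma inj_tail_end: "inj tail_end"
  by (auto simp: inj_on_def tail_end_def)

lemma inj_head_end: "inj head_end"
proof (rule injI)
  fix p q assume "head_end p = head_end q"
  then have "\<pi> (fst p) (snd p) = \<pi> (fst q) (snd q)" "fst p = fst q"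
    by (auto simp: head_end_def case_prod_beta)
  then show "p = q" using perm_eq_iff by (metis prod.expand)
qed

text \<open>Rounding \<open>S\<close> to the union of its majority clusters spoils at most two bridges per misplaced
  vertex.\<close>
definition bridge_cut :: "nat set \<Rightarrow> nat set set" where
  "bridge_cut S = (\<lambda>p. {tail_end p, head_end p}) `
     {(j, i). j < r \<and> i < m \<and> (i \<in> majority_clusters S) \<noteq> (\<pi> j i \<in> majority_clusters S) \<and>
        (tail_end (j, i) \<in> S) = (i \<in> majority_clusters S) \<and>
        (head_end (j, i) \<in> S) = (\<pi> j i \<in> majority_clusters S)}"

lemma card_bridge_cut:
  assumes S: "S \<subseteq> V"
  defines "X \<equiv> majority_clusters S"
  shows "(\<Sum>j<r. card {i \<in> {..<m}. (i \<in> X) \<noteq> (\<pi> j i \<in> X)})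
           \<le> card (bridge_cut S) + 2 * (\<Sum>i<m. minority S i)"
proof -
  let ?D = "{v \<in> V. (v \<in> S) \<noteq> (cluster_of v \<in> X)}"
  define Q where "Q = Sigma {..<r} (\<lambda>j. {i \<in> {..<m}. (i \<in> X) \<noteq> (\<pi> j i \<in> X)})"
  define Q' where "Q' = {(j, i). j < r \<and> i < m \<and> (i \<in> X) \<noteq> (\<pi> j i \<in> X) \<and>
        (tail_end (j, i) \<in> S) = (i \<in> X) \<and> (head_end (j, i) \<in> S) = (\<pi> j i \<in> X)}"
  have fD: "finite ?D" using finite_V by simp
  have fQ: "finite Q" unfolding Q_def by auto
  have "inj_on (\<lambda>p. {tail_end p, head_end p}) Q'"
  proof (rule inj_onI)
    fix p q assume p: "p \<in> Q'" and q: "q \<in> Q'" and eq: "{tail_end p, head_end p} = {tail_end q, head_end q}"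
    obtain j i j' i' where pq: "p = (j, i)" "q = (j', i')" by (cases p, cases q)
    have "j < r" using p pq by (auto simp: Q'_def)
    then have "tail_end p \<noteq> head_end q"
      using half_bounds(1)[of "\<pi> j' i'"] by (auto simp: tail_end_def head_end_def pq)
    then have "tail_end p = tail_end q" using eq by (auto simp: doubleton_eq_iff)
    then show "p = q" using inj_tail_end by (auto dest: injD)
  qed
  then have cut: "card (bridge_cut S) = card Q'"
    unfolding bridge_cut_def X_def[symmetric] Q'_def[symmetric] by (rule card_image)
  have "card (Q \<inter> tail_end -` ?D) \<le> card ?D"
    using fD inj_on_subset[OF inj_tail_end] by (intro card_inj_on_le[of tail_end]) auto
  moreover have "card (Q \<inter> head_end -` ?D) \<le> card ?D"
    using fD inj_on_subset[OF inj_head_end] by (intro card_inj_on_le[of head_end]) auto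
  moreover have "Q \<subseteq> Q' \<union> (Q \<inter> tail_end -` ?D) \<union> (Q \<inter> head_end -` ?D)"
  proof
    fix p assume p: "p \<in> Q"
    then obtain j i where ji: "p = (j, i)" "j < r" "i < m" "(i \<in> X) \<noteq> (\<pi> j i \<in> X)"
      by (auto simp: Q_def)
    have "cluster_of (tail_end p) = i" "cluster_of (head_end p) = \<pi> j i"
      by (auto simp: ji tail_end_def head_end_def)
    then show "p \<in> Q' \<union> (Q \<inter> tail_end -` ?D) \<union> (Q \<inter> head_end -` ?D)"
      using p ji ends_in_V[OF ji(2,3)] by (auto simp: Q'_def)
  qed
  then have "card Q \<le> card (Q' \<union> (Q \<inter> tail_end -` ?D) \<union> (Q \<inter> head_end -` ?D))"
    using fQ by (intro card_mono) (auto simp: Q'_def Q_def intro: finite_subset[of _ "{..<r} \<times> {..<m}"])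
  moreover have "\<dots> \<le> card Q' + card (Q \<inter> tail_end -` ?D) + card (Q \<inter> head_end -` ?D)"
    by (meson add_le_mono card_Un_le le_refl le_trans)
  moreover have "card Q = (\<Sum>j<r. card {i \<in> {..<m}. (i \<in> X) \<noteq> (\<pi> j i \<in> X)})"
    unfolding Q_def by simp
  moreover have "card ?D = (\<Sum>i<m. minority S i)"
    unfolding X_def by (rule card_misplaced[OF S])
  ultimately show ?thesis using cut by linarith
qed

lemma edge_boundary_ge_cuts:
  assumes S: "S \<subseteq> V"
  shows "(\<Sum>i<m. card (inner_cut S i)) + card (bridge_cut S) \<le> edge_boundary (V, E) S"
proof -
  have fE: "finite E"
    by (rule finite_subset[of _ "Pow V"]) (auto simp: E_def finite_V)
  have in_sub: "inner_cut S i \<subseteq> {e \<in> E. card (e \<inter> S) = 1 \<and> cluster_of ` e = {i}}" for i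
  proof
    fix e assume "e \<in> inner_cut S i"
    then obtain x y where e: "e = {x, y}" "x \<in> slice S i" "y \<in> slice V i - S"
      "\<not> removed i (position_of x) (position_of y)" by (auto simp: inner_cut_def)
    then have "adj x y" "x \<in> V" "y \<in> V" using S by (auto simp: adj_def slice_def)
    then have "e \<in> E" using e(1) by (auto simp: E_def)
    moreover have "e \<inter> S = {x}" using e by (auto simp: slice_def)
    moreover have "cluster_of ` e = {i}" using e by (auto simp: slice_def)
    ultimately show "e \<in> {e \<in> E. card (e \<inter> S) = 1 \<and> cluster_of ` e = {i}}" by simp
  qed
  have br_sub: "bridge_cut S \<subseteq> {e \<in> E. card (e \<inter> S) = 1 \<and> card (cluster_of ` e) = 2}"
  proof
    fix e assume "e \<in> bridge_cut S"
    then obtain j i where e': "e = {tail_end (j, i), head_end (j, i)}" "j < r" "i < m"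
      "(i \<in> majority_clusters S) \<noteq> (\<pi> j i \<in> majority_clusters S)"
      "(tail_end (j, i) \<in> S) = (i \<in> majority_clusters S)"
      "(head_end (j, i) \<in> S) = (\<pi> j i \<in> majority_clusters S)"
      unfolding bridge_cut_def by blast
    then have e: "e = {tail_end (j, i), head_end (j, i)}" "j < r" "i < m"
      "(tail_end (j, i) \<in> S) \<noteq> (head_end (j, i) \<in> S)" "i \<noteq> \<pi> j i"
      by metis+
    have "e \<in> E" using ends_in_V[OF e(2,3)] e(1) by (auto simp: E_def adj_def)
    moreover have "card (e \<inter> S) = 1" using e(1,4) by (auto simp: Int_insert_left)
    moreover have "cluster_of ` e = {i, \<pi> j i}" using e(1) by (auto simp: tail_end_def head_end_def)
    ultimately show "e \<in> {e \<in> E. card (e \<inter> S) = 1 \<and> card (cluster_of ` e) = 2}"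
      using e(5) by simp
  qed
  have fin: "finite (inner_cut S i)" for i using in_sub[of i] fE finite_subset by fastforce
  have finb: "finite (bridge_cut S)" using br_sub fE finite_subset by fastforce
  have "(\<Sum>i<m. card (inner_cut S i)) = card (\<Union>i<m. inner_cut S i)"
  proof (rule card_UN_disjoint[symmetric])
    show "\<forall>i\<in>{..<m}. \<forall>j\<in>{..<m}. i \<noteq> j \<longrightarrow> inner_cut S i \<inter> inner_cut S j = {}"
    proof (intro ballI impI equals0I)
      fix i j e assume "i \<noteq> j" "e \<in> inner_cut S i \<inter> inner_cut S j"
      then have "cluster_of ` e = {i}" "cluster_of ` e = {j}"
        using in_sub[of i] in_sub[of j] by blast+
      then show False using \<open>i \<noteq> j\<close> by simp
    qed
  qed (use fin in auto)
  then have "(\<Sum>i<m. card (inner_cut S i)) + card (bridge_cut S) =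
      card ((\<Union>i<m. inner_cut S i) \<union> bridge_cut S)"
  proof (subst card_Un_disjoint)
    show "(\<Union>i<m. inner_cut S i) \<inter> bridge_cut S = {}"
    proof (rule equals0I)
      fix e assume "e \<in> (\<Union>i<m. inner_cut S i) \<inter> bridge_cut S"
      then obtain i where "e \<in> inner_cut S i" "e \<in> bridge_cut S" by blast
      then have "cluster_of ` e = {i}" "card (cluster_of ` e) = 2"
        using in_sub[of i] br_sub by auto
      then show False by simp
    qed
  qed (use fin finb in auto)
  also have "\<dots> \<le> edge_boundary (V, E) S"
    unfolding edge_boundary_def using fE in_sub br_sub by (intro card_mono) auto
  finally show ?thesis .
qed

lemma sum_indicator_le:
  assumes "X \<subseteq> {..<m}" and "\<And>i. i < m \<Longrightarrow> f i \<le> (if i \<in> X then d + 3 else 0) + g i"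
  shows "(\<Sum>i<m. f i) \<le> (d + 3) * card X + (\<Sum>i<m. g i)"
proof -
  have "(\<Sum>i<m. f i) \<le> (\<Sum>i<m. (if i \<in> X then d + 3 else 0) + g i)"
    using assms by (intro sum_mono) auto
  also have "\<dots> = (\<Sum>i<m. if i \<in> X then d + 3 else 0) + (\<Sum>i<m. g i)"
    by (rule sum.distrib)
  also have "(\<Sum>i<m. if i \<in> X then d + 3 else 0) = (d + 3) * card X"
    using assms(1) by (simp add: sum.If_cases Int_absorb1)
  finally show ?thesis .
qed

lemma edge_boundary_ge:
  assumes expand: "\<And>X. X \<subseteq> {..<m} \<Longrightarrow> real r * real (min (card X) (m - card X)) / 4
              \<le> (\<Sum>j<r. real (card {i \<in> {..<m}. (i \<in> X) \<noteq> (\<pi> j i \<in> X)}))"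
    and S: "S \<subseteq> V" and half: "2 * card S \<le> card V"
  shows "real r / (4 * real (d + 3)) * real (card S) \<le> real (edge_boundary (V, E) S)"
proof -
  define X where "X = majority_clusters S"
  define \<delta> where "\<delta> = (\<Sum>i<m. minority S i)"
  define y where "y = min (card X) (m - card X)"
  have X: "X \<subseteq> {..<m}" by (auto simp: X_def majority_clusters_def)
  then have fX: "finite X" using finite_subset by blast
  have "card S = (\<Sum>i<m. card (slice S i))" by (rule sum_card_slices[OF S])
  also have "\<dots> \<le> (d + 3) * card X + \<delta>"
    unfolding \<delta>_def
  proof (rule sum_indicator_le[OF X])
    fix i assume i: "i < m"
    show "card (slice S i) \<le> (if i \<in> X then d + 3 else 0) + minority S i"
      using card_slice_le[OF S i] size[of i] i
      by (auto simp: X_def majority_clusters_def minority_def)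
  qed
  finally have S1: "card S \<le> (d + 3) * card X + \<delta>" .
  have "card S \<le> card (V - S)"
    using half S finite_V finite_subset[OF S finite_V] by (simp add: card_Diff_subset)
  also have "\<dots> = (\<Sum>i<m. card (slice (V - S) i))" by (rule sum_card_slices) auto
  also have "\<dots> \<le> (d + 3) * card ({..<m} - X) + \<delta>"
    unfolding \<delta>_def
  proof (rule sum_indicator_le)
    fix i assume i: "i < m"
    have "slice (V - S) i = slice V i - S" by (auto simp: slice_def)
    then show "card (slice (V - S) i) \<le> (if i \<in> {..<m} - X then d + 3 else 0) + minority S i"
      using card_slice_le[OF S i] card_slice_Diff[OF S i] size[of i] i
      by (auto simp: X_def majority_clusters_def minority_def)
  qed auto
  also have "card ({..<m} - X) = m - card X" using X fX by (simp add: card_Diff_subset)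
  finally have S2: "card S \<le> (d + 3) * (m - card X) + \<delta>" .
  have "card S \<le> (d + 3) * y + \<delta>" using S1 S2 by (auto simp: y_def min_def)
  then have "real (card S) \<le> real ((d + 3) * y + \<delta>)" by (simp only: of_nat_le_iff)
  then have Sy: "real (card S) \<le> real (d + 3) * real y + real \<delta>" by simp
  have "(\<Sum>i<m. real (minority S i) * ((real d - 5) / 2)) \<le> (\<Sum>i<m. real (card (inner_cut S i)))"
    using card_inner_cut[OF S] by (intro sum_mono) auto
  then have inner: "real \<delta> * ((real d - 5) / 2) \<le> real (\<Sum>i<m. card (inner_cut S i))"
    by (simp add: \<delta>_def sum_distrib_right sum_divide_distrib)
  have "real r * real y / 4 \<le> real (\<Sum>j<r. card {i \<in> {..<m}. (i \<in> X) \<noteq> (\<pi> j i \<in> X)})"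
    using expand[OF X] by (simp add: y_def)
  also have "\<dots> \<le> real (card (bridge_cut S) + 2 * \<delta>)"
    using card_bridge_cut[OF S] unfolding X_def \<delta>_def by (simp only: of_nat_le_iff)
  finally have outer: "real r * real y / 4 - 2 * real \<delta> \<le> real (card (bridge_cut S))" by simp
  have "real (\<Sum>i<m. card (inner_cut S i)) + real (card (bridge_cut S)) \<le> real (edge_boundary (V, E) S)"
    using edge_boundary_ge_cuts[OF S] by (simp only: of_nat_add[symmetric] of_nat_le_iff)
  moreover have "real \<delta> * ((real d - 9) / 2) = real \<delta> * ((real d - 5) / 2) - 2 * real \<delta>"
    by (simp add: field_simps)
  ultimately have low:
    "real r * real y / 4 + real \<delta> * ((real d - 9) / 2) \<le> real (edge_boundary (V, E) S)"
    using inner outer by linarith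
  let ?\<kappa> = "real r / (4 * real (d + 3))"
  have \<kappa>: "0 \<le> ?\<kappa>" "?\<kappa> \<le> 1" using r_le by (auto simp: field_simps)
  have "?\<kappa> * real (card S) \<le> ?\<kappa> * (real (d + 3) * real y + real \<delta>)"
    by (rule mult_left_mono[OF Sy \<kappa>(1)])
  also have "\<dots> = real r * real y / 4 + ?\<kappa> * real \<delta>"
    by (simp add: field_simps)
  also have "\<dots> \<le> real r * real y / 4 + ((real d - 9) / 2) * real \<delta>"
  proof (intro add_left_mono mult_right_mono)
    have "11 \<le> real d" using d_ge by simp
    then have "1 \<le> (real d - 9) / 2" by simp
    then show "?\<kappa> \<le> (real d - 9) / 2" by (rule order_trans[OF \<kappa>(2)])
  qed simp
  finally show ?thesis using low by (simp add: mult.commute)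
qed

lemma isoperimetric_constant_ge:
  assumes expand: "\<And>X. X \<subseteq> {..<m} \<Longrightarrow> real r * real (min (card X) (m - card X)) / 4
              \<le> (\<Sum>j<r. real (card {i \<in> {..<m}. (i \<in> X) \<noteq> (\<pi> j i \<in> X)}))"
    and m: "0 < m"
  shows "real r / (4 * real (d + 3)) \<le> isoperimetric_constant (V, E)"
proof -
  let ?A = "{real (edge_boundary (V, E) S) / real (card S) | S.
            S \<subseteq> V \<and> 1 \<le> card S \<and> real (card S) \<le> real (card V) / 2}"
  have "?A \<subseteq> (\<lambda>S. real (edge_boundary (V, E) S) / real (card S)) ` Pow V" by auto
  then have "finite ?A" using finite_V by (meson finite_Pow_iff finite_imageI finite_subset)
  moreover have "?A \<noteq> {}"
  proof -
    have "s 0 \<le> (\<Sum>i<m. s i)" using m by (intro member_le_sum) auto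
    then have "2 \<le> card V" using card_V size[of 0] d_ge by auto
    moreover have "vx 0 0 \<in> V" using m size[of 0] by (auto simp: vx_in_V_iff)
    ultimately have "{vx 0 0} \<subseteq> V \<and> 1 \<le> card {vx 0 0} \<and> real (card {vx 0 0}) \<le> real (card V) / 2"
      by auto
    then show ?thesis by blast
  qed
  moreover have "real r / (4 * real (d + 3)) \<le> x" if x: "x \<in> ?A" for x
  proof -
    obtain S where S: "x = real (edge_boundary (V, E) S) / real (card S)" "S \<subseteq> V" "1 \<le> card S"
      "real (card S) \<le> real (card V) / 2" using x by blast
    have "2 * card S \<le> card V" using S(4) by linarith
    then have "real r / (4 * real (d + 3)) * real (card S) \<le> real (edge_boundary (V, E) S)"
      using expand S(2) by (intro edge_boundary_ge) auto
    then show ?thesis unfolding S(1) using S(3) by (subst pos_le_divide_eq) auto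
  qed
  ultimately show ?thesis unfolding isoperimetric_constant_def fst_conv using Min_ge_iff[of ?A] by blast
qed

end

section \<open>Choice of parameters\<close>

lemma exists_cluster_sizes:
  fixes n d :: nat
  assumes d: "1 \<le> d" and n: "4 * d ^ 2 \<le> n" and ev: "even (n * d)"
  shows "\<exists>m b. n = m * (d + 1) + 2 * b \<and> b \<le> m \<and> 0 < m"
proof -
  define q \<rho> where "q = n div (d + 1)" and "\<rho> = n mod (d + 1)"
  have n_eq: "n = q * (d + 1) + \<rho>" by (simp only: q_def \<rho>_def div_mult_mod_eq)
  have \<rho>: "\<rho> \<le> d" using mod_less_divisor[of "d + 1" n] unfolding \<rho>_def by linarith
  have "(d + 1) * (d + 1) \<le> (2 * d) * (2 * d)" using d by (intro mult_le_mono) auto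
  also have "\<dots> \<le> n" using n by (simp add: power2_eq_square)
  finally have q: "d + 1 \<le> q"
    unfolding q_def by (subst less_eq_div_iff_mult_less_eq) auto
  show ?thesis
  proof (cases "even \<rho>")
    case True
    then show ?thesis using n_eq \<rho> q by (intro exI[of _ q] exI[of _ "\<rho> div 2"]) auto
  next
    case False
    have "even d"
    proof (rule ccontr)
      assume "odd d"
      then have "even n" "even (q * (d + 1))" using ev by auto
      then show False using False n_eq by (metis even_add)
    qed
    then have e: "2 * ((\<rho> + d + 1) div 2) = \<rho> + d + 1" using False by auto
    have "q * (d + 1) = (q - 1) * (d + 1) + (d + 1)"
      using q by (cases q) auto
    then have "n = (q - 1) * (d + 1) + 2 * ((\<rho> + d + 1) div 2)"
      using n_eq e by linarith
    moreover have "(\<rho> + d + 1) div 2 \<le> q - 1" using q e \<rho> False \<open>even d\<close> by presburger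
    ultimately show ?thesis using q d by (intro exI[of _ "q - 1"] exI[of _ "(\<rho> + d + 1) div 2"]) auto
  qed
qed

lemma exp_23_20_le: "exp (23 / 20 :: real) \<le> 4"
proof -
  have "exp (23 / 20 :: real) ^ 20 = exp 1 ^ 23"
    by (simp add: exp_of_nat_mult[symmetric])
  also have "\<dots> \<le> 3 ^ 23" using exp_le by (intro power_mono) auto
  also have "\<dots> \<le> (4 :: real) ^ 20" by simp
  finally show ?thesis by (subst (asm) power_mono_iff) auto
qed

lemma branching_weight_le:
  fixes p :: real
  assumes p: "0 \<le> p" and rp: "real r * p \<le> 1 / 8"
  shows "exp (2 / 5) * (1 - p + p * 4) ^ (2 * r) \<le> 4"
proof -
  have "(1 - p + p * 4) ^ (2 * r) \<le> exp (3 * p) ^ (2 * r)"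
  proof (rule power_mono)
    show "1 - p + p * 4 \<le> exp (3 * p)" using exp_ge_add_one_self[of "3 * p"] by linarith
  qed (use p in simp)
  also have "\<dots> = exp (6 * (real r * p))"
    by (simp add: exp_of_nat_mult[symmetric] mult_ac)
  also have "\<dots> \<le> exp (3 / 4)" by (subst exp_le_cancel_iff) (use rp in linarith)
  finally have "exp (2 / 5) * (1 - p + p * 4) ^ (2 * r) \<le> exp (2 / 5) * exp (3 / 4)"
    by (intro mult_left_mono) auto
  also have "\<dots> = exp (23 / 20)" by (simp flip: exp_add)
  finally show ?thesis using exp_23_20_le by linarith
qed

lemma exists_rewired_cluster_graph:
  fixes C :: real and d n :: nat
  assumes C: "C > 1" and d: "1000 * C \<le> real d" and n: "4 * d ^ 2 \<le> n" and ev: "even (n * d)"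
  shows "\<exists>G :: nat ugraph. finite_simple_graph G \<and> card (verts G) = n \<and> regular_graph d G \<and>
      isoperimetric_constant G \<ge> 1 / (40 * C) \<and>
      (\<forall>p. 0 \<le> p \<longrightarrow> p \<le> 1 \<longrightarrow> p \<le> C / real d \<longrightarrow>
         measure_pmf.prob (random_subgraph G p)
           {H. \<not> (\<forall>K\<in>graph_components H. real (card K) \<le> 3 * real d * ln (real n))}
         \<le> 4 * real n powr (- 1 / 10))"
proof -
  have d1000: "1000 \<le> d" using C d by linarith
  obtain m b where mb: "n = m * (d + 1) + 2 * b" "b \<le> m" "0 < m"
    using exists_cluster_sizes[of d n] d1000 n ev by auto
  define r where "r = nat \<lfloor>real d / (8 * C)\<rfloor>"
  have "0 \<le> real d / (8 * C)" using C by simp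
  then have r1: "real r \<le> real d / (8 * C)" and r2: "real d / (8 * C) < real r + 1"
    unfolding r_def by linarith+
  have rC: "8 * C * real r \<le> real d" using r1 C by (simp add: field_simps)
  have rC2: "real d < 8 * C * (real r + 1)" using r2 C by (simp add: field_simps)
  have r124: "124 \<le> r"
  proof -
    have "125 \<le> real d / (8 * C)" using d C by (simp add: field_simps)
    then show ?thesis using r2 by linarith
  qed
  have r2d: "2 * r \<le> d"
  proof -
    have "8 * real r \<le> 8 * C * real r" using C by (intro mult_right_mono) auto
    then show ?thesis using rC by linarith
  qed
  obtain \<pi> :: "nat \<Rightarrow> nat \<Rightarrow> nat" where perm: "\<And>j. \<pi> j permutes {..<m}"
    and expand: "\<And>X. X \<subseteq> {..<m} \<Longrightarrow> real r * real (min (card X) (m - card X)) / 4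
              \<le> (\<Sum>j<r. real (card {i \<in> {..<m}. (i \<in> X) \<noteq> (\<pi> j i \<in> X)}))"
    using exists_expanding_permutations_cut[OF r124, of m] by blast
  define s where "s = (\<lambda>i. if i < b then d + 3 else d + 1)"
  interpret rewired_clusters m r d s \<pi>
    by unfold_locales (use perm r2d d1000 in \<open>auto simp: s_def\<close>)
  have cV: "card V = n"
  proof -
    have "card V = (\<Sum>i<m. (d + 1) + (if i \<in> {..<b} then 2 else 0))"
      unfolding card_V by (rule sum.cong) (auto simp: s_def)
    also have "\<dots> = m * (d + 1) + (\<Sum>i<m. if i \<in> {..<b} then 2 else 0)"
      by (simp only: sum.distrib sum_constant card_lessThan of_nat_id distrib_left)
    also have "(\<Sum>i<m. if i \<in> {..<b} then 2 else 0 :: nat) = 2 * b"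
    proof -
      have "{..<m} \<inter> {..<b} = {..<b}" using mb(2) by auto
      then show ?thesis by (subst sum.inter_restrict[symmetric]) auto
    qed
    finally show ?thesis using mb(1) by simp
  qed
  have "1 / (40 * C) \<le> real r / (4 * real (d + 3))"
  proof -
    have "4 * real (d + 3) \<le> 40 * (C * real r)"
      using rC2 d C by (simp add: algebra_simps)
    then show ?thesis using C by (simp add: field_simps)
  qed
  also have "\<dots> \<le> isoperimetric_constant (V, E)"
    using expand mb(3) by (rule isoperimetric_constant_ge)
  finally have iso: "1 / (40 * C) \<le> isoperimetric_constant (V, E)" .
  have npos: "0 < n" using mb by auto
  have prob: "measure_pmf.prob (random_subgraph (V, E) p)
           {H. \<not> (\<forall>K\<in>graph_components H. real (card K) \<le> 3 * real d * ln (real n))}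
         \<le> 4 * real n powr (- 1 / 10)" (is "?P \<le> _")
    if p: "0 \<le> p" "p \<le> 1" "p \<le> C / real d" for p
  proof -
    have "real r * p \<le> real r * (C / real d)" using p by (intro mult_left_mono) auto
    also have "\<dots> \<le> 1 / 8" using rC d1000 by (simp add: field_simps)
    finally have rp: "real r * p \<le> 1 / 8" .
    let ?L = "3 * real d * ln (real n)"
    have "?P \<le> real (card (cluster_of ` verts (V, E))) * 4 / exp (2 / 5) powr (?L / (d + 3))"
      by (rule prob_large_component_le[where k = "2 * r"])
        (use finite_simple_graph_VE card_cluster_le card_leaving_edges_le p branching_weight_le[OF p(1) rp]
          in auto)
    also have "\<dots> \<le> real n * 4 / real n powr (11 / 10)"
    proof (rule frac_le)
      have "card (cluster_of ` V) \<le> n" using card_image_le[OF finite_V, of cluster_of] cV by simp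
      then show "real (card (cluster_of ` verts (V, E))) * 4 \<le> real n * 4" by simp
      have "11 / 10 \<le> 2 / 5 * (3 * real d / real (d + 3))"
        using d1000 by (simp add: field_simps)
      then have "11 / 10 * ln (real n) \<le> 2 / 5 * (3 * real d / real (d + 3)) * ln (real n)"
        using npos by (intro mult_right_mono) auto
      then have "11 / 10 * ln (real n) \<le> ?L / real (d + 3) * (2 / 5)" by (simp add: mult_ac)
      then show "real n powr (11 / 10) \<le> exp (2 / 5) powr (?L / real (d + 3))"
        using npos by (simp add: powr_def)
    qed (use npos in auto)
    also have "\<dots> = 4 * (real n powr 1 / real n powr (11 / 10))" using npos by simp
    also have "\<dots> = 4 * real n powr (- 1 / 10)" by (simp only: powr_diff[symmetric]) simp
    finally show ?thesis .
  qed
  show ?thesis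
    using finite_simple_graph_VE cV regular_VE iso prob by (intro exI[of _ "(V, E)"]) auto
qed

theorem theorem1p3:
  fixes C :: real and d n :: "nat \<Rightarrow> nat" and p :: "nat \<Rightarrow> real"
  assumes "C > 1"
    and "(\<lambda>k. real (d k)) \<in> \<omega>(\<lambda>_. 1)"
    and "(\<lambda>k. real (n k)) \<in> \<omega>(\<lambda>k. real (d k) ^ 2)"
    and "\<And>k. 0 \<le> p k \<and> p k \<le> 1"
    and "\<And>k. p k \<le> C / real (d k)"
    and "\<And>k. even (n k * d k)"
  shows "\<exists>G :: nat \<Rightarrow> nat ugraph.
           (\<forall>\<^sub>F k in sequentially.
              finite_simple_graph (G k) \<and> card (verts (G k)) = n k \<and>
              regular_graph (d k) (G k) \<and>
              isoperimetric_constant (G k) \<ge> 1 / (40 * C)) \<and>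
           (\<lambda>k. measure_pmf.prob (random_subgraph (G k) (p k))
                  {H. \<forall>K\<in>graph_components H. real (card K) \<le> 3 * real (d k) * ln (real (n k))})
             \<longlonglongrightarrow> 1"
proof -
  define good where "good = (\<lambda>k. 1000 * C \<le> real (d k) \<and> 4 * d k ^ 2 \<le> n k)"
  let ?bad = "\<lambda>k. {H :: nat ugraph. \<not> (\<forall>K\<in>graph_components H. real (card K) \<le> 3 * real (d k) * ln (real (n k)))}"
  have d_large: "\<forall>\<^sub>F k in sequentially. c \<le> real (d k)" if "c > 0" for c
    using landau_omega.smallD[OF assms(2) that] by simp
  have "\<forall>\<^sub>F k in sequentially. 4 * real (d k) ^ 2 \<le> real (n k)"
    using landau_omega.smallD[OF assms(3), of 4] by simp
  then have "\<forall>\<^sub>F k in sequentially. 4 * d k ^ 2 \<le> n k"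
    by eventually_elim (simp flip: of_nat_le_iff[where 'a = real])
  then have good: "\<forall>\<^sub>F k in sequentially. good k"
    using d_large[of "1000 * C"] assms(1) unfolding good_def by (auto intro: eventually_conj)
  have "\<forall>k. \<exists>G :: nat ugraph. good k \<longrightarrow> finite_simple_graph G \<and> card (verts G) = n k \<and>
      regular_graph (d k) G \<and> isoperimetric_constant G \<ge> 1 / (40 * C) \<and>
      measure_pmf.prob (random_subgraph G (p k)) (?bad k) \<le> 4 * real (n k) powr (- 1 / 10)"
  proof
    fix k
    show "\<exists>G :: nat ugraph. good k \<longrightarrow> finite_simple_graph G \<and> card (verts G) = n k \<and>
      regular_graph (d k) G \<and> isoperimetric_constant G \<ge> 1 / (40 * C) \<and>
      measure_pmf.prob (random_subgraph G (p k)) (?bad k) \<le> 4 * real (n k) powr (- 1 / 10)"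
      using exists_rewired_cluster_graph[OF assms(1) _ _ assms(6), of k] assms(4,5)[of k]
      unfolding good_def by blast
  qed
  from choice[OF this] obtain G :: "nat \<Rightarrow> nat ugraph" where
    G: "\<And>k. good k \<Longrightarrow> finite_simple_graph (G k) \<and> card (verts (G k)) = n k \<and>
      regular_graph (d k) (G k) \<and> isoperimetric_constant (G k) \<ge> 1 / (40 * C)"
    and bad: "\<And>k. good k \<Longrightarrow>
      measure_pmf.prob (random_subgraph (G k) (p k)) (?bad k) \<le> 4 * real (n k) powr (- 1 / 10)"
    by blast
  have "filterlim (\<lambda>k. real (n k)) at_top sequentially"
    unfolding filterlim_at_top
  proof
    fix Z :: real
    have "\<forall>\<^sub>F k in sequentially. max 1 Z \<le> real (d k)" by (rule d_large) simp
    with good show "\<forall>\<^sub>F k in sequentially. Z \<le> real (n k)"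
    proof eventually_elim
      case (elim k)
      then have "d k \<le> d k ^ 2" by (cases "d k") (auto simp: power2_eq_square)
      then have "d k \<le> n k" using elim(1) unfolding good_def by linarith
      then have "real (d k) \<le> real (n k)" by (simp only: of_nat_le_iff)
      then show ?case using elim(2) by linarith
    qed
  qed
  then have "(\<lambda>k. real (n k) powr (- 1 / 10)) \<longlonglongrightarrow> 0"
    by (intro tendsto_neg_powr) auto
  then have lim: "(\<lambda>k. 1 - 4 * real (n k) powr (- 1 / 10)) \<longlonglongrightarrow> 1"
    using tendsto_diff[OF tendsto_const tendsto_mult_right_zero, of _ sequentially 1 4] by simp
  have "(\<lambda>k. measure_pmf.prob (random_subgraph (G k) (p k)) (- ?bad k)) \<longlonglongrightarrow> 1"
  proof (rule tendsto_sandwich[OF _ _ lim tendsto_const])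
    show "\<forall>\<^sub>F k in sequentially. 1 - 4 * real (n k) powr (- 1 / 10)
        \<le> measure_pmf.prob (random_subgraph (G k) (p k)) (- ?bad k)"
      using good
    proof eventually_elim
      case (elim k)
      then show ?case
        using bad[OF elim] measure_pmf.prob_compl[of "?bad k" "random_subgraph (G k) (p k)"]
        by (simp add: Compl_eq_Diff_UNIV)
    qed
  qed auto
  moreover have "- ?bad k = {H. \<forall>K\<in>graph_components H. real (card K) \<le> 3 * real (d k) * ln (real (n k))}" for k
    by auto
  moreover have "\<forall>\<^sub>F k in sequentially. finite_simple_graph (G k) \<and> card (verts (G k)) = n k \<and>
      regular_graph (d k) (G k) \<and> isoperimetric_constant (G k) \<ge> 1 / (40 * C)"
    using good by eventually_elim (rule G)
  ultimately show ?thesis by (intro exI[of _ G]) simp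
qed

end
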